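(* There is an absolute constant $C$ such that the following holds. Let $A\in L^2_{\rm loc}(\mathbb{R}^+)$ be the (complex-valued) coefficient of a Krein system with solution $(P,P_* )$ and orthogonality measure $\sigma$, and suppose that $A$ belongs to the Stummel class, i.e. $$\|A\|_{\rm St}:=\sup_{r\ge0}\left(\int_r^{r+1}|A(\rho)|^2d\rho\right)^{1/2}<\infty .$$ Then $$\sup_{r>0}\int_{\mathbb{R}}\frac{|P(r,k)|^2}{1+k^2}\,d\sigma(k)\le C\left(1+\|A\|_{\rm St}^2\right).$$ Moreover, with $\kappa(k)=1+k^2$ and $K:=\sup_{r\ge 0}\int_{\mathbb{R}}\frac{|P(r,k)|^2}{\kappa(k)}d\sigma(k)$, one has $K\le C(1+\|A\|_{\rm St}^2)$, and for every $f$ with $f(r)\log(2+r)\in L^2(\mathbb{R}^+)$, $$\int_{\mathbb{R}}\sup_{t>0}\left|\int_0^t f(r)P(r,k)\,dr\right|^2\frac{d\sigma(k)}{\kappa(k)}\le C\left(\|\kappa^{-1}\|_{L^\infty(\mathbb{R})}+K\right)\int_0^\infty|f(r)|^2\log^2(2+r)\,dr ,$$ and, as $R\to\infty$, $\int_0^R f(r)P(r,k)\,dr\to\int_0^\infty f(r)P(r,k)\,dr$ for $\sigma$-a.e. $k\in\mathbb{R}$.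
   Context: $\mathbb{R}^+=[0,\infty)$; $A\in L^2_{\rm loc}(\mathbb{R}^+)$ means $\int_0^a|A(r)|^2dr<\infty$ for all $a>0$. The Krein system with coefficient $A$ is the Cauchy problem $$\begin{cases}P'(r,k)=ikP(r,k)-\overline{A(r)}\,P_*(r,k),& P(0,k)=1,\\ P_*'(r,k)=-A(r)P(r,k),& P_*(0,k)=1,\end{cases}\qquad k\in\mathbb{C},\ r\ge0,$$ where $'$ is the derivative in $r$; it has a unique solution $(P(r,k),P_*(r,k))$ (absolutely continuous in $r$). By a theorem of Krein there is a measure $\sigma$ on $\mathbb{R}$ (the orthogonality, or spectral, measure of the system) with $\int_{\mathbb{R}}\frac{d\sigma(k)}{1+k^2}<\infty$ and $$\int_{\mathbb{R}}\left|\int_0^a f(r)P(r,k)\,dr\right|^2d\sigma(k)=\int_0^a|f(r)|^2dr$$ for every $f\in L^2(\mathbb{R}^+)$ and every $a>0$. For $f\in L^2(\mathbb{R}^+)$, $\int_0^\infty f(r)P(r,k)\,dr$ denotes the limit in $L^2_\sigma(\mathbb{R})$ of $\int_0^R f(r)P(r,k)\,dr$ as $R\to\infty$. *)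

theory Defs
  imports "HOL-Analysis.Analysis" "HOL-Probability.Essential_Supremum"
begin

text \<open>
  Functions on the half-line are represented by total functions on \<^typ>\<open>real\<close>; their values at
  negative arguments are never used.  Functions of \<open>r\<close> are Lebesgue (not necessarily Borel)
  measurable, so all integrals in \<open>r\<close> are taken with respect to \<^const>\<open>lebesgue\<close>.
\<close>

definition L2_half_line :: "(real \<Rightarrow> complex) \<Rightarrow> bool" where
  "L2_half_line f \<longleftrightarrow>
     f \<in> borel_measurable (lebesgue_on {0..}) \<and>
     integrable (lebesgue_on {0..}) (\<lambda>r. (cmod (f r))\<^sup>2)"

definition L2_loc_half_line :: "(real \<Rightarrow> complex) \<Rightarrow> bool" where
  "L2_loc_half_line A \<longleftrightarrow>
     A \<in> borel_measurable (lebesgue_on {0..}) \<and>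
     (\<forall>a>0. integrable (lebesgue_on {0..a}) (\<lambda>r. (cmod (A r))\<^sup>2))"

text \<open>
  The epsilon-delta definition.  A division \<open>D\<close> is a finite family of non-overlapping
  compact intervals; \<open>S\<close> is its union, and an interval \<open>J\<close> is \<open>{Inf J..Sup J}\<close>.
\<close>

definition abs_cont_on :: "real \<Rightarrow> real \<Rightarrow> (real \<Rightarrow> complex) \<Rightarrow> bool" where
  "abs_cont_on a b f \<longleftrightarrow>
     (\<forall>\<epsilon>>0. \<exists>\<delta>>0. \<forall>D S.
        D division_of S \<and> S \<subseteq> {a..b} \<and> (\<Sum>J\<in>D. Sup J - Inf J) < \<delta> \<longrightarrow>
        (\<Sum>J\<in>D. cmod (f (Sup J) - f (Inf J))) < \<epsilon>)"

text \<open>Since \<open>A\<close> is only locally square integrable, the equations hold for almost every \<open>r\<close>.\<close>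

definition krein_system ::
  "(real \<Rightarrow> complex) \<Rightarrow> (real \<Rightarrow> complex \<Rightarrow> complex) \<Rightarrow> (real \<Rightarrow> complex \<Rightarrow> complex) \<Rightarrow> bool" where
  "krein_system A P Pstar \<longleftrightarrow>
     (\<forall>k::complex.
        P 0 k = 1 \<and> Pstar 0 k = 1 \<and>
        (\<forall>a>0. abs_cont_on 0 a (\<lambda>r. P r k) \<and> abs_cont_on 0 a (\<lambda>r. Pstar r k)) \<and>
        (AE r in lebesgue. 0 < r \<longrightarrow>
           ((\<lambda>s. P s k) has_vector_derivative (\<i> * k * P r k - cnj (A r) * Pstar r k)) (at r) \<and>
           ((\<lambda>s. Pstar s k) has_vector_derivative (- A r * P r k)) (at r)))"

text \<open>The integral of \<open>f(r) P(r,k)\<close> over \<open>[0,a]\<close>, for real \<open>k\<close>.\<close>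

definition krein_transform ::
  "(real \<Rightarrow> complex \<Rightarrow> complex) \<Rightarrow> (real \<Rightarrow> complex) \<Rightarrow> real \<Rightarrow> real \<Rightarrow> complex" where
  "krein_transform P f a k = (LINT r:{0..a}|lebesgue. f r * P r (complex_of_real k))"

definition orthogonality_measure ::
  "(real \<Rightarrow> complex \<Rightarrow> complex) \<Rightarrow> real measure \<Rightarrow> bool" where
  "orthogonality_measure P \<sigma> \<longleftrightarrow>
     sets \<sigma> = sets borel \<and>
     (\<integral>\<^sup>+k. ennreal (1 / (1 + k\<^sup>2)) \<partial>\<sigma>) < \<infinity> \<and>
     (\<forall>f a. L2_half_line f \<and> a > 0 \<longrightarrow>
        (\<integral>\<^sup>+k. ennreal ((cmod (krein_transform P f a k))\<^sup>2) \<partial>\<sigma>) =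
        (\<integral>\<^sup>+r\<in>{0..a}. ennreal ((cmod (f r))\<^sup>2) \<partial>lebesgue))"

text \<open>\<open>F\<close> represents the integral of \<open>f(r) P(r,k)\<close> over the half-line, i.e. the limit in
  \<open>L\<^sup>2(\<sigma>)\<close> of the integrals over \<open>[0,R]\<close>; it is unique up to \<open>\<sigma>\<close>-null sets.\<close>

definition krein_transform_L2_limit ::
  "(real \<Rightarrow> complex \<Rightarrow> complex) \<Rightarrow> real measure \<Rightarrow> (real \<Rightarrow> complex) \<Rightarrow> (real \<Rightarrow> complex) \<Rightarrow> bool" where
  "krein_transform_L2_limit P \<sigma> f F \<longleftrightarrow>
     F \<in> borel_measurable \<sigma> \<and>
     (\<integral>\<^sup>+k. ennreal ((cmod (F k))\<^sup>2) \<partial>\<sigma>) < \<infinity> \<and>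
     ((\<lambda>R. \<integral>\<^sup>+k. ennreal ((cmod (krein_transform P f R k - F k))\<^sup>2) \<partial>\<sigma>) \<longlongrightarrow> 0) at_top"

definition local_L2_norm :: "(real \<Rightarrow> complex) \<Rightarrow> real \<Rightarrow> real" where
  "local_L2_norm A r = sqrt (LINT \<rho>:{r..r+1}|lebesgue. (cmod (A \<rho>))\<^sup>2)"

definition stummel_class :: "(real \<Rightarrow> complex) \<Rightarrow> bool" where
  "stummel_class A \<longleftrightarrow> L2_loc_half_line A \<and> bdd_above (local_L2_norm A ` {0..})"

definition stummel_norm :: "(real \<Rightarrow> complex) \<Rightarrow> real" where
  "stummel_norm A = (SUP r\<in>{0..}. local_L2_norm A r)"

definition kappa :: "real \<Rightarrow> real" where
  "kappa k = 1 + k\<^sup>2"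

definition Linf_norm :: "(real \<Rightarrow> real) \<Rightarrow> ennreal" where
  "Linf_norm g = esssup lebesgue (\<lambda>x. ennreal \<bar>g x\<bar>)"

definition krein_K :: "(real \<Rightarrow> complex \<Rightarrow> complex) \<Rightarrow> real measure \<Rightarrow> ennreal" where
  "krein_K P \<sigma> =
     (SUP r\<in>{0..}. \<integral>\<^sup>+k. ennreal ((cmod (P r (complex_of_real k)))\<^sup>2 / kappa k) \<partial>\<sigma>)"

end

(*
  On an interval of length delta with delta comparable to 1/(1 + ||A||^2) the L^1 norm of A is at
  most 1/4, and |P| = |P_*| for real k, so |P| at most doubles there.  Integrating (r + delta - s) P(s)
  by parts expresses delta P(r) through transforms of two functions supported on [r, r + delta], up to an
  error of at most delta |P(r)| / 2; the isometry then bounds K by a multiple of 1/delta.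

  For the maximal inequality, the partial integrals up to integers are controlled by a
  Rademacher-Menshov argument, which uses only the isometry on intervals.  Inside a unit block the
  integrals are controlled by Cauchy-Schwarz and a Riemann sum of |P|^2 with step delta, whose
  weighted integral is bounded by K.  Almost everywhere convergence follows by applying the maximal
  inequality to the tails of f.
*)
theory Submission
  imports Defs
begin

text \<open>The isometry speaks of \<open>P\<close> only. In the integration by parts the
  coefficient term contains \<open>Pstar\<close>, for which no such identity is at hand, so it has
  to be absorbed pointwise; this is why the step must be so short that the integral of
  \<open>cmod A\<close> is small. The term \<open>\<i> * k * P\<close> leaves a factor
  \<open>\<bar>k\<bar>\<close> in front of one of the two transforms, and Cauchy-Schwarz turns it
  into the weight \<open>1 + k^2\<close>. The isometry itself is unweighted: in the maximal
  inequality only the part inside unit blocks calls for \<open>kappa\<close> and contributes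
  \<open>K\<close>, while the part along the integers is absorbed into \<open>Linf_norm\<close>,
  which is bounded below. Two matters of rigour shape the rest. Derivatives exist only almost
  everywhere and absolute continuity is the epsilon-delta notion, so the fundamental theorem of
  calculus is proved with gauges. The hypotheses give no measurability of \<open>P\<close> in
  \<open>k\<close>, yet integrals over \<open>\<sigma>\<close> must be added and passed to limits;
  hence continuity in \<open>k\<close> is derived by a Gronwall argument.\<close>

section \<open>Absolutely continuous functions\<close>

lemma abs_cont_onD:
  assumes "abs_cont_on a b f" "\<epsilon> > 0"
  obtains \<delta> where "\<delta> > 0"
    "\<And>D S. D division_of S \<Longrightarrow> S \<subseteq> {a..b} \<Longrightarrow> (\<Sum>J\<in>D. Sup J - Inf J) < \<delta> \<Longrightarrow>
      (\<Sum>J\<in>D. cmod (f (Sup J) - f (Inf J))) < \<epsilon>"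
  using assms unfolding abs_cont_on_def by meson

lemma division_of_member_Icc:
  fixes J :: "real set"
  assumes "D division_of S" "J \<in> D"
  shows "Inf J \<in> S" "Sup J \<in> S" "Inf J \<le> Sup J" "J = {Inf J..Sup J}"
proof -
  obtain u v where J: "J = cbox u v" "J \<noteq> {}" "J \<subseteq> S"
    using division_ofD(2-4)[OF assms(1) assms(2)] by metis
  then have "u \<le> v" by auto
  then have "Inf J = u" "Sup J = v" using J by auto
  then show "Inf J \<in> S" "Sup J \<in> S" "Inf J \<le> Sup J" "J = {Inf J..Sup J}"
    using J \<open>u \<le> v\<close> by auto
qed

lemma abs_cont_on_imp_continuous_on:
  assumes "abs_cont_on a b f"
  shows "continuous_on {a..b} f"
proof -
  have "\<exists>d>0. \<forall>x'\<in>{a..b}. dist x' x < d \<longrightarrow> dist (f x') (f x) < e"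
    if "x \<in> {a..b}" "e > 0" for x e
  proof -
    obtain \<delta> where "\<delta> > 0" and \<delta>: "\<And>D S. D division_of S \<Longrightarrow> S \<subseteq> {a..b} \<Longrightarrow>
        (\<Sum>J\<in>D. Sup J - Inf J) < \<delta> \<Longrightarrow> (\<Sum>J\<in>D. cmod (f (Sup J) - f (Inf J))) < e"
      using abs_cont_onD[OF assms \<open>e > 0\<close>] by blast
    \<comment> \<open>A single interval is a division of itself.\<close>
    have *: "cmod (f v - f u) < e" if "u \<le> v" "v - u < \<delta>" "u \<in> {a..b}" "v \<in> {a..b}" for u v
      using \<delta>[OF division_of_self[of u v]] that by simp
    have "dist (f x') (f x) < e" if "x' \<in> {a..b}" "dist x' x < \<delta>" for x'
      using *[of x x'] *[of x' x] that \<open>x \<in> {a..b}\<close>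
      by (cases "x \<le> x'") (auto simp: dist_norm norm_minus_commute)
    then show ?thesis using \<open>\<delta> > 0\<close> by blast
  qed
  then show ?thesis unfolding continuous_on_iff by blast
qed

lemma abs_cont_on_mult:
  assumes f: "abs_cont_on a b f" and g: "abs_cont_on a b g"
  shows "abs_cont_on a b (\<lambda>x. f x * g x)"
  unfolding abs_cont_on_def
proof (intro allI impI)
  fix e :: real assume "e > 0"
  have "bounded (f ` {a..b})" "bounded (g ` {a..b})"
    using assms by (auto intro!: compact_imp_bounded compact_continuous_image
        abs_cont_on_imp_continuous_on)
  then obtain B C where B: "B > 0" "\<And>x. x \<in> {a..b} \<Longrightarrow> cmod (f x) \<le> B"
    and C: "C > 0" "\<And>x. x \<in> {a..b} \<Longrightarrow> cmod (g x) \<le> C"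
    by (auto simp: bounded_pos)
  have "e / (2 * C) > 0" "e / (2 * B) > 0" using B C \<open>e > 0\<close> by auto
  obtain d1 where "d1 > 0" and d1: "\<And>D S. D division_of S \<Longrightarrow> S \<subseteq> {a..b} \<Longrightarrow>
      (\<Sum>J\<in>D. Sup J - Inf J) < d1 \<Longrightarrow> (\<Sum>J\<in>D. cmod (f (Sup J) - f (Inf J))) < e / (2 * C)"
    using abs_cont_onD[OF f \<open>e / (2 * C) > 0\<close>] by blast
  obtain d2 where "d2 > 0" and d2: "\<And>D S. D division_of S \<Longrightarrow> S \<subseteq> {a..b} \<Longrightarrow>
      (\<Sum>J\<in>D. Sup J - Inf J) < d2 \<Longrightarrow> (\<Sum>J\<in>D. cmod (g (Sup J) - g (Inf J))) < e / (2 * B)"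
    using abs_cont_onD[OF g \<open>e / (2 * B) > 0\<close>] by blast
  show "\<exists>\<delta>>0. \<forall>D S. D division_of S \<and> S \<subseteq> {a..b} \<and> (\<Sum>J\<in>D. Sup J - Inf J) < \<delta> \<longrightarrow>
        (\<Sum>J\<in>D. cmod (f (Sup J) * g (Sup J) - f (Inf J) * g (Inf J))) < e"
  proof (rule exI[of _ "min d1 d2"], intro conjI allI impI)
    show "min d1 d2 > 0" using \<open>d1 > 0\<close> \<open>d2 > 0\<close> by simp
    fix D S assume *: "D division_of S \<and> S \<subseteq> {a..b} \<and> (\<Sum>J\<in>D. Sup J - Inf J) < min d1 d2"
    have "(\<Sum>J\<in>D. cmod (f (Sup J) * g (Sup J) - f (Inf J) * g (Inf J)))
        \<le> (\<Sum>J\<in>D. cmod (f (Sup J) - f (Inf J)) * C + B * cmod (g (Sup J) - g (Inf J)))"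
    proof (rule sum_mono)
      fix J assume "J \<in> D"
      then have J: "Inf J \<in> {a..b}" "Sup J \<in> {a..b}"
        using division_of_member_Icc(1,2)[of D S J] * by auto
      have "f (Sup J) * g (Sup J) - f (Inf J) * g (Inf J)
        = (f (Sup J) - f (Inf J)) * g (Sup J) + f (Inf J) * (g (Sup J) - g (Inf J))"
        by (simp add: algebra_simps)
      then have "cmod (f (Sup J) * g (Sup J) - f (Inf J) * g (Inf J))
        \<le> cmod (f (Sup J) - f (Inf J)) * cmod (g (Sup J)) + cmod (f (Inf J)) * cmod (g (Sup J) - g (Inf J))"
        using norm_triangle_ineq by (metis norm_mult)
      also have "\<dots> \<le> cmod (f (Sup J) - f (Inf J)) * C + B * cmod (g (Sup J) - g (Inf J))"
        by (intro add_mono mult_left_mono mult_right_mono B C J norm_ge_zero)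
      finally show "cmod (f (Sup J) * g (Sup J) - f (Inf J) * g (Inf J))
        \<le> cmod (f (Sup J) - f (Inf J)) * C + B * cmod (g (Sup J) - g (Inf J))" .
    qed
    also have "\<dots> = (\<Sum>J\<in>D. cmod (f (Sup J) - f (Inf J))) * C + B * (\<Sum>J\<in>D. cmod (g (Sup J) - g (Inf J)))"
      by (simp add: sum.distrib sum_distrib_left sum_distrib_right)
    also have "\<dots> < e / (2 * C) * C + B * (e / (2 * B))"
      using B(1) C(1) d1[of D S] d2[of D S] *
      by (intro add_strict_mono mult_strict_right_mono mult_strict_left_mono) auto
    also have "\<dots> = e" using B(1) C(1) by simp
    finally show "(\<Sum>J\<in>D. cmod (f (Sup J) * g (Sup J) - f (Inf J) * g (Inf J))) < e" .
  qed
qed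

lemma lipschitz_imp_abs_cont_on:
  assumes "\<And>x y. x \<in> {a..b} \<Longrightarrow> y \<in> {a..b} \<Longrightarrow> cmod (f x - f y) \<le> L * \<bar>x - y\<bar>"
  shows "abs_cont_on a b f"
  unfolding abs_cont_on_def
proof (intro allI impI)
  fix e :: real assume "e > 0"
  show "\<exists>\<delta>>0. \<forall>D S. D division_of S \<and> S \<subseteq> {a..b} \<and> (\<Sum>J\<in>D. Sup J - Inf J) < \<delta> \<longrightarrow>
        (\<Sum>J\<in>D. cmod (f (Sup J) - f (Inf J))) < e"
  \<comment> \<open>The sign of \<open>L\<close> is not known; \<open>1 + \<bar>L\<bar>\<close> is a
    positive Lipschitz constant that dominates it.\<close>
  proof (rule exI[of _ "e / (1 + \<bar>L\<bar>)"], intro conjI allI impI)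
    have L: "1 + \<bar>L\<bar> > 0" by linarith
    show "e / (1 + \<bar>L\<bar>) > 0" using \<open>e > 0\<close> L by (rule divide_pos_pos)
    fix D S assume *: "D division_of S \<and> S \<subseteq> {a..b} \<and> (\<Sum>J\<in>D. Sup J - Inf J) < e / (1 + \<bar>L\<bar>)"
    have "(\<Sum>J\<in>D. cmod (f (Sup J) - f (Inf J))) \<le> (\<Sum>J\<in>D. (1 + \<bar>L\<bar>) * (Sup J - Inf J))"
    proof (rule sum_mono)
      fix J assume "J \<in> D"
      then have J: "Inf J \<in> {a..b}" "Sup J \<in> {a..b}" "Inf J \<le> Sup J"
        using division_of_member_Icc[of D S J] * by auto
      have "cmod (f (Sup J) - f (Inf J)) \<le> L * \<bar>Sup J - Inf J\<bar>" using assms J by blast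
      also have "\<dots> \<le> (1 + \<bar>L\<bar>) * \<bar>Sup J - Inf J\<bar>" by (intro mult_right_mono) auto
      finally show "cmod (f (Sup J) - f (Inf J)) \<le> (1 + \<bar>L\<bar>) * (Sup J - Inf J)" using J by simp
    qed
    also have "\<dots> = (1 + \<bar>L\<bar>) * (\<Sum>J\<in>D. Sup J - Inf J)" by (simp add: sum_distrib_left)
    also have "\<dots> < (1 + \<bar>L\<bar>) * (e / (1 + \<bar>L\<bar>))"
      using * L by (intro mult_strict_left_mono) auto
    also have "\<dots> = e" using L by simp
    finally show "(\<Sum>J\<in>D. cmod (f (Sup J) - f (Inf J))) < e" .
  qed
qed

lemma abs_cont_on_cnj:
  assumes "abs_cont_on a b f"
  shows "abs_cont_on a b (\<lambda>x. cnj (f x))"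
proof -
  have "cmod (cnj x - cnj y) = cmod (x - y)" for x y
    by (metis complex_cnj_diff complex_mod_cnj)
  with assms show ?thesis unfolding abs_cont_on_def by simp
qed

lemma abs_cont_on_diff:
  assumes f: "abs_cont_on a b f" and g: "abs_cont_on a b g"
  shows "abs_cont_on a b (\<lambda>x. f x - g x)"
  unfolding abs_cont_on_def
proof (intro allI impI)
  fix e :: real assume "e > 0"
  then have "e/2 > 0" by simp
  obtain d1 where "d1 > 0" and d1: "\<And>D S. D division_of S \<Longrightarrow> S \<subseteq> {a..b} \<Longrightarrow>
      (\<Sum>J\<in>D. Sup J - Inf J) < d1 \<Longrightarrow> (\<Sum>J\<in>D. cmod (f (Sup J) - f (Inf J))) < e/2"
    using abs_cont_onD[OF f \<open>e/2 > 0\<close>] by blast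
  obtain d2 where "d2 > 0" and d2: "\<And>D S. D division_of S \<Longrightarrow> S \<subseteq> {a..b} \<Longrightarrow>
      (\<Sum>J\<in>D. Sup J - Inf J) < d2 \<Longrightarrow> (\<Sum>J\<in>D. cmod (g (Sup J) - g (Inf J))) < e/2"
    using abs_cont_onD[OF g \<open>e/2 > 0\<close>] by blast
  show "\<exists>\<delta>>0. \<forall>D S. D division_of S \<and> S \<subseteq> {a..b} \<and> (\<Sum>J\<in>D. Sup J - Inf J) < \<delta> \<longrightarrow>
        (\<Sum>J\<in>D. cmod (f (Sup J) - g (Sup J) - (f (Inf J) - g (Inf J)))) < e"
  proof (rule exI[of _ "min d1 d2"], intro conjI allI impI)
    show "min d1 d2 > 0" using \<open>d1 > 0\<close> \<open>d2 > 0\<close> by simp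
    fix D S assume *: "D division_of S \<and> S \<subseteq> {a..b} \<and> (\<Sum>J\<in>D. Sup J - Inf J) < min d1 d2"
    have "(\<Sum>J\<in>D. cmod (f (Sup J) - g (Sup J) - (f (Inf J) - g (Inf J))))
        \<le> (\<Sum>J\<in>D. cmod (f (Sup J) - f (Inf J)) + cmod (g (Sup J) - g (Inf J)))"
    proof (rule sum_mono)
      fix J
      have eq: "f (Sup J) - g (Sup J) - (f (Inf J) - g (Inf J)) =
          (f (Sup J) - f (Inf J)) - (g (Sup J) - g (Inf J))" by simp
      show "cmod (f (Sup J) - g (Sup J) - (f (Inf J) - g (Inf J)))
          \<le> cmod (f (Sup J) - f (Inf J)) + cmod (g (Sup J) - g (Inf J))"
        unfolding eq by (rule norm_triangle_ineq4)
    qed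
    also have "\<dots> < e/2 + e/2"
      unfolding sum.distrib using d1[of D S] d2[of D S] * by (intro add_strict_mono) auto
    finally show "(\<Sum>J\<in>D. cmod (f (Sup J) - g (Sup J) - (f (Inf J) - g (Inf J)))) < e" by simp
  qed
qed

lemma abs_cont_on_subset:
  "abs_cont_on a b f \<Longrightarrow> a \<le> c \<Longrightarrow> d \<le> b \<Longrightarrow> abs_cont_on c d f"
  unfolding abs_cont_on_def atLeastatMost_subset_iff[symmetric]
  by (elim all_forward imp_forward ex_forward conj_forward asm_rl) (auto simp: subset_iff)

section \<open>Fundamental theorem of calculus for absolutely continuous functions\<close>

lemma sum_length_division:
  fixes D :: "real set set"
  assumes "D division_of S"
  shows "(\<Sum>J\<in>D. Sup J - Inf J) = measure lebesgue S"
proof -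
  have "(\<Sum>J\<in>D. Sup J - Inf J) = (\<Sum>J\<in>D. measure lebesgue J)"
  proof (rule sum.cong[OF refl])
    fix J assume "J \<in> D"
    note J = division_of_member_Icc[OF assms this]
    show "Sup J - Inf J = measure lebesgue J" by (subst (3) J(4)) (use J(3) in simp)
  qed
  then show ?thesis using content_division[OF assms] by simp
qed

text \<open>A gauge that follows the derivative off the exceptional null set and shrinks into a small
  open superset of that set on it makes every fine Riemann sum close to the increment of \<open>f\<close>.\<close>

theorem abs_cont_on_has_integral:
  assumes f: "abs_cont_on a b f" and "a \<le> b"
    and der: "AE x in lebesgue. a < x \<and> x < b \<longrightarrow> (f has_vector_derivative g x) (at x)"
  shows "(g has_integral (f b - f a)) {a..b}"
proof -
  obtain N where N: "negligible N"
      "{x. \<not> (a < x \<and> x < b \<longrightarrow> (f has_vector_derivative g x) (at x))} \<subseteq> N"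
    using der by (auto simp: eventually_ae_filter_negligible)
  \<comment> \<open>The end points join the exceptional set because the derivative is known only at
    interior points.\<close>
  define E where "E = insert a (insert b N)"
  have negE: "negligible E" using N by (simp add: E_def)
  have derE: "(f has_vector_derivative g x) (at x)" if "x \<in> {a..b}" "x \<notin> E" for x
    using N that by (auto simp: E_def less_eq_real_def)
  \<comment> \<open>A change on a null set does not affect the integral. With value zero on
    \<open>E\<close>, a pair tagged in \<open>E\<close> contributes only an increment of
    \<open>f\<close>.\<close>
  define h where "h x = (if x \<in> E then 0 else g x)" for x
  have "(h has_integral (f b - f a)) {a..b}"
    unfolding has_integral_real
  proof (intro allI impI)
    fix e :: real assume "e > 0"
    \<comment> \<open>The tags outside \<open>E\<close> cost at most
      \<open>\<eta> * (b - a)\<close>, which this choice keeps below \<open>e / 2\<close>; the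
      \<open>+ 1\<close> covers \<open>a = b\<close>.\<close>
    define \<eta> where "\<eta> = e / (2 * (b - a + 1))"
    have "\<eta> > 0" using \<open>e > 0\<close> \<open>a \<le> b\<close> by (simp add: \<eta>_def)
    have "\<exists>d>0. x \<in> {a..b} - E \<longrightarrow>
        (\<forall>y. norm (y - x) < d \<longrightarrow> norm (f y - f x - (y - x) *\<^sub>R g x) \<le> \<eta> * norm (y - x))" for x
    proof (cases "x \<in> {a..b} - E")
      case True
      then show ?thesis
        using derE[of x] \<open>\<eta> > 0\<close> unfolding has_vector_derivative_def has_derivative_within_alt by blast
    qed (auto intro: exI[of _ 1])
    then obtain d where d0: "\<And>x. 0 < d x" and d: "\<And>x y. x \<in> {a..b} - E \<Longrightarrow> norm (y - x) < d x \<Longrightarrow>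
        norm (f y - f x - (y - x) *\<^sub>R g x) \<le> \<eta> * norm (y - x)"
      by metis
    have "e/2 > 0" using \<open>e > 0\<close> by simp
    obtain \<delta> where "\<delta> > 0" and \<delta>: "\<And>D S. D division_of S \<Longrightarrow> S \<subseteq> {a..b} \<Longrightarrow>
        (\<Sum>J\<in>D. Sup J - Inf J) < \<delta> \<Longrightarrow> (\<Sum>J\<in>D. cmod (f (Sup J) - f (Inf J))) < e/2"
      using abs_cont_onD[OF f \<open>e/2 > 0\<close>] by blast
    have nullE: "E \<in> null_sets lebesgue" using negE by (simp add: negligible_iff_null_sets)
    \<comment> \<open>Intervals tagged in \<open>E\<close> will lie in \<open>U\<close>, so their
      total length stays below the \<open>\<delta>\<close> of absolute continuity.\<close>
    obtain U where U: "open U" "E \<subseteq> U" "U - E \<in> lmeasurable" "emeasure lebesgue (U - E) < ennreal \<delta>"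
      using sets_lebesgue_outer_open[of E \<delta>] nullE \<open>\<delta> > 0\<close> by blast
    have UE: "U = (U - E) \<union> E" using U by auto
    have Umeas: "U \<in> lmeasurable"
      by (subst UE) (intro fmeasurable.Un U negligible_imp_measurable negE)
    have "emeasure lebesgue U \<le> emeasure lebesgue (U - E) + emeasure lebesgue E"
      by (subst UE) (rule emeasure_subadditive; use U nullE in auto)
    also have "\<dots> = emeasure lebesgue (U - E)" using nullE by (simp add: null_setsD1)
    finally have "emeasure lebesgue U < ennreal \<delta>" using U by simp
    then have Udel: "measure lebesgue U < \<delta>"
      using Umeas \<open>\<delta> > 0\<close> by (simp add: emeasure_eq_measure2 ennreal_less_iff)
    define \<gamma> where "\<gamma> x = (if x \<in> E then U else ball x (d x))" for x
    have "gauge \<gamma>" unfolding gauge_def \<gamma>_def using U d0 by auto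
    moreover have "norm ((\<Sum>(x, K)\<in>p. measure lborel K *\<^sub>R h x) - (f b - f a)) < e"
      if ptag: "p tagged_division_of {a..b}" and fine: "\<gamma> fine p" for p
    proof -
      have fin: "finite p" using ptag by (rule tagged_division_of_finite)
      have inc: "f b - f a = (\<Sum>(x,K)\<in>p. f (Sup K) - f (Inf K))"
        and len: "b - a = (\<Sum>(x,K)\<in>p. Sup K - Inf K)"
        using additive_tagged_division_1[where f=f] additive_tagged_division_1[where f="\<lambda>x. x"]
          \<open>a \<le> b\<close> ptag by auto
      have K: "\<exists>u v. u \<le> v \<and> K = {u..v} \<and> u \<le> x \<and> x \<le> v \<and> a \<le> u \<and> v \<le> b" if xK: "(x,K) \<in> p" for x K
      proof -
        obtain u v where "K = cbox u v" using tagged_division_ofD(4)[OF ptag xK] by blast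
        moreover have "x \<in> K" "K \<subseteq> {a..b}" using tagged_division_ofD(2,3)[OF ptag xK] by auto
        ultimately show ?thesis by (intro exI[of _ u] exI[of _ v]) auto
      qed
      define pE where "pE = {q \<in> p. fst q \<in> E}"
      define pR where "pR = {q \<in> p. fst q \<notin> E}"
      have pp: "p = pR \<union> pE" "pR \<inter> pE = {}" "finite pE" "finite pR"
        using fin by (auto simp: pE_def pR_def)
      let ?t = "\<lambda>q. measure lborel (snd q) *\<^sub>R h (fst q) - (f (Sup (snd q)) - f (Inf (snd q)))"
      have "(\<Sum>(x, K)\<in>p. measure lborel K *\<^sub>R h x) - (f b - f a) = (\<Sum>q\<in>p. ?t q)"
        by (simp add: inc split_def sum_subtractf)
      also have "\<dots> = (\<Sum>q\<in>pR. ?t q) + (\<Sum>q\<in>pE. ?t q)"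
        by (subst pp(1)) (rule sum.union_disjoint[OF pp(4,3,2)])
      finally have eq: "(\<Sum>(x, K)\<in>p. measure lborel K *\<^sub>R h x) - (f b - f a)
        = (\<Sum>q\<in>pR. ?t q) + (\<Sum>q\<in>pE. ?t q)" .
      have "norm (\<Sum>q\<in>pR. ?t q) \<le> (\<Sum>q\<in>pR. \<eta> * (Sup (snd q) - Inf (snd q)))"
      proof (rule sum_norm_le)
        fix q assume q: "q \<in> pR"
        obtain x K where xK: "q = (x, K)" "(x, K) \<in> p" "x \<notin> E" using q by (cases q) (auto simp: pR_def)
        then obtain u v where uv: "u \<le> v" "K = {u..v}" "u \<le> x" "x \<le> v" "a \<le> u" "v \<le> b"
          using K by blast
        have "K \<subseteq> ball x (d x)" using fineD[OF fine xK(2)] xK(3) by (simp add: \<gamma>_def)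
        then have "u \<in> ball x (d x)" "v \<in> ball x (d x)" using uv by (auto simp: subset_iff simp del: mem_ball)
        then have nd: "norm (u - x) < d x" "norm (v - x) < d x"
          by (auto simp: dist_real_def abs_minus_commute)
        have hx: "h x = g x" using xK by (simp add: h_def)
        \<comment> \<open>The increment is split at the tag \<open>x\<close>; as
          \<open>u \<le> x \<le> v\<close>, the two error bounds add up to
          \<open>\<eta> * (v - u)\<close>.\<close>
        have "?t q = (f u - f x - (u - x) *\<^sub>R g x) - (f v - f x - (v - x) *\<^sub>R g x)"
          using uv by (simp add: xK hx algebra_simps)
        then have "norm (?t q) \<le> norm (f u - f x - (u - x) *\<^sub>R g x) + norm (f v - f x - (v - x) *\<^sub>R g x)"
          by (simp only: norm_triangle_ineq4)
        also have "\<dots> \<le> \<eta> * norm (u - x) + \<eta> * norm (v - x)"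
          using d[of x u] d[of x v] nd xK uv by (intro add_mono) auto
        also have "\<dots> = \<eta> * (Sup (snd q) - Inf (snd q))"
          using uv by (simp add: xK algebra_simps)
        finally show "norm (?t q) \<le> \<eta> * (Sup (snd q) - Inf (snd q))" .
      qed
      also have "\<dots> \<le> (\<Sum>q\<in>p. \<eta> * (Sup (snd q) - Inf (snd q)))"
      proof (rule sum_mono2[OF fin])
        fix q assume "q \<in> p - pR"
        then show "0 \<le> \<eta> * (Sup (snd q) - Inf (snd q))"
          using K[of "fst q" "snd q"] \<open>\<eta> > 0\<close> by auto
      qed (auto simp: pR_def)
      also have "\<dots> = \<eta> * (b - a)" by (simp add: len split_def sum_distrib_left)
      also have "\<dots> < e/2" using \<open>e > 0\<close> \<open>a \<le> b\<close> by (simp add: \<eta>_def field_simps)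
      finally have R: "norm (\<Sum>q\<in>pR. ?t q) < e/2" .
      have pEpart: "pE tagged_partial_division_of {a..b}"
        using ptag unfolding tagged_division_of_def
        by (auto intro: tagged_partial_division_subset simp: pE_def)
      define S where "S = \<Union>(snd ` pE)"
      have pEtag: "pE tagged_division_of S"
        unfolding S_def by (rule tagged_partial_division_of_Union_self[OF pEpart])
      then have div: "snd ` pE division_of S" by (rule division_of_tagged_division)
      have SU: "S \<subseteq> U"
      proof -
        have "snd q \<subseteq> U" if "q \<in> pE" for q
          using fineD[OF fine, of "fst q" "snd q"] that by (simp add: pE_def \<gamma>_def)
        then show ?thesis unfolding S_def by blast
      qed
      have Sab: "S \<subseteq> {a..b}"
      proof -
        have "snd q \<subseteq> {a..b}" if "q \<in> pE" for q
          using tagged_partial_division_ofD(3)[OF pEpart, of "fst q" "snd q"] that by simp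
        then show ?thesis unfolding S_def by blast
      qed
      have Sm: "S \<in> lmeasurable" using div by (rule lmeasurable_division)
      have "(\<Sum>J\<in>snd ` pE. Sup J - Inf J) \<le> measure lebesgue U"
        unfolding sum_length_division[OF div] using SU Sm Umeas
        by (intro measure_mono_fmeasurable) auto
      then have small: "(\<Sum>J\<in>snd ` pE. cmod (f (Sup J) - f (Inf J))) < e/2"
        using \<delta>[OF div Sab] Udel by simp
      \<comment> \<open>Passing from tagged pairs to their intervals may merge pairs that share a
        degenerate interval, so the summand has to vanish on those. The same requirement covers the
        empty interval, whose \<open>Sup\<close> and \<open>Inf\<close> carry no
        information.\<close>
      let ?c = "\<lambda>J. if J = {} then 0 else cmod (f (Sup J) - f (Inf J))"
      have "norm (\<Sum>q\<in>pE. ?t q) \<le> (\<Sum>q\<in>pE. ?c (snd q))"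
      proof (rule sum_norm_le)
        fix q assume "q \<in> pE"
        then obtain x J where q: "q = (x, J)" "(x, J) \<in> p" "x \<in> E" by (cases q) (auto simp: pE_def)
        then have "J \<noteq> {}" using K[OF q(2)] by auto
        then show "norm (?t q) \<le> ?c (snd q)"
          using q(3) by (simp add: q(1) h_def norm_minus_commute)
      qed
      also have "\<dots> = (\<Sum>(x,J)\<in>pE. ?c J)" by (simp add: split_def)
      also have "\<dots> = (\<Sum>J\<in>snd ` pE. ?c J)"
      proof (rule sum.over_tagged_division_lemma[OF pEtag])
        fix u v :: real assume "box u v = {}"
        then show "?c (cbox u v) = 0" by (cases "u = v") auto
      qed
      also have "\<dots> \<le> (\<Sum>J\<in>snd ` pE. cmod (f (Sup J) - f (Inf J)))"
        by (rule sum_mono) auto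
      finally have "norm (\<Sum>q\<in>pE. ?t q) < e/2" using small by simp
      with R show ?thesis
        unfolding eq using norm_triangle_ineq[of "\<Sum>q\<in>pR. ?t q" "\<Sum>q\<in>pE. ?t q"] by linarith
    qed
    ultimately show "\<exists>\<gamma>. gauge \<gamma> \<and> (\<forall>p. p tagged_division_of {a..b} \<and> \<gamma> fine p \<longrightarrow>
        norm ((\<Sum>(x, K)\<in>p. measure lborel K *\<^sub>R h x) - (f b - f a)) < e)"
      by (intro exI[of _ \<gamma>] conjI allI impI) (assumption, elim conjE)
  qed
  then show ?thesis
    by (rule has_integral_spike[OF negE, rotated]) (auto simp: h_def)
qed

section \<open>The Rademacher--Menshov inequality\<close>

text \<open>The two sides differ by \<open>(a - t * b)^2 / t\<close>. The free \<open>t\<close> is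
  tuned to the level of the dyadic recursion below.\<close>

lemma square_add_le:
  fixes a b t :: real
  assumes "t > 0"
  shows "(a + b)\<^sup>2 \<le> (1 + 1/t) * a\<^sup>2 + (1 + t) * b\<^sup>2"
proof -
  have "0 \<le> (a - t * b)\<^sup>2 / t" using assms by simp
  also have "\<dots> = a\<^sup>2 / t - 2 * a * b + t * b\<^sup>2"
    using assms by (simp add: field_simps power2_eq_square)
  finally show ?thesis by (simp add: algebra_simps power2_eq_square)
qed

lemma square_add3_le:
  fixes a b c :: real
  shows "(a + b + c)\<^sup>2 \<le> 3 * a\<^sup>2 + 3 * b\<^sup>2 + 3 * c\<^sup>2"
proof -
  have "0 \<le> (a - b)\<^sup>2 + (b - c)\<^sup>2 + (a - c)\<^sup>2" by simp
  then show ?thesis by (simp add: algebra_simps power2_eq_square)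
qed

lemma nn_integral_add_le:
  assumes [measurable]: "f \<in> borel_measurable M" "g \<in> borel_measurable M"
    and "(\<integral>\<^sup>+x. f x \<partial>M) \<le> ennreal a" "(\<integral>\<^sup>+x. g x \<partial>M) \<le> ennreal b" "0 \<le> a" "0 \<le> b"
  shows "(\<integral>\<^sup>+x. f x + g x \<partial>M) \<le> ennreal (a + b)"
  using assms(3-6) by (simp add: nn_integral_add ennreal_plus add_mono del: ennreal_plus[symmetric])

lemma nn_integral_cmult_le:
  assumes [measurable]: "f \<in> borel_measurable M"
    and "(\<integral>\<^sup>+x. f x \<partial>M) \<le> ennreal a" "0 \<le> c"
  shows "(\<integral>\<^sup>+x. ennreal c * f x \<partial>M) \<le> ennreal (c * a)"
  using assms(2,3) by (simp add: nn_integral_cmult ennreal_mult' mult_left_mono)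

text \<open>\<open>V\<close> is a cumulative energy. Orthogonality enters the Rademacher-Menshov
  argument only through this bound for single increments, which the isometry on intervals provides;
  there \<open>V n\<close> is the integral of \<open>(cmod (f r))^2\<close> over
  \<open>[0, n]\<close>.\<close>

locale increment_bound =
  fixes M :: "'a measure" and S :: "nat \<Rightarrow> 'a \<Rightarrow> complex" and V :: "nat \<Rightarrow> real"
  assumes S_measurable [measurable]: "\<And>n. S n \<in> borel_measurable M"
    and increment: "\<And>i j. i \<le> j \<Longrightarrow>
      (\<integral>\<^sup>+x. ennreal ((cmod (S j x - S i x))\<^sup>2) \<partial>M) \<le> ennreal (V j - V i)"
    and V_mono: "\<And>i j. i \<le> j \<Longrightarrow> V i \<le> V j"
begin

definition block_max :: "nat \<Rightarrow> nat \<Rightarrow> 'a \<Rightarrow> ennreal" where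
  "block_max c m x = (SUP j\<in>{..2^m}. ennreal ((cmod (S (c + j) x - S c x))\<^sup>2))"

lemma block_max_measurable [measurable]: "block_max c m \<in> borel_measurable M"
  unfolding block_max_def by measurable

lemma block_max_upper: "j \<le> 2^m \<Longrightarrow> ennreal ((cmod (S (c + j) x - S c x))\<^sup>2) \<le> block_max c m x"
  unfolding block_max_def by (intro SUP_upper) simp

text \<open>The path to an index in the right half goes through the midpoint \<open>c + 2^m\<close>.
  The maximum over the two halves is replaced by a sum, which is harmless because the energies of
  the halves add up. Taking \<open>t = m + 1\<close> puts the factor close to 1 on the recursive
  maxima and the large factor on the single midpoint increment.\<close>

lemma block_max_Suc:
  "block_max c (Suc m) x \<le>
     ennreal (1 + 1 / (real m + 1)) * (block_max c m x + block_max (c + 2^m) m x) +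
     ennreal (real m + 2) * ennreal ((cmod (S (c + 2^m) x - S c x))\<^sup>2)" (is "_ \<le> ?r")
  unfolding block_max_def[of c "Suc m"]
proof (rule SUP_least)
  fix j :: nat assume j: "j \<in> {..2 ^ Suc m}"
  show "ennreal ((cmod (S (c + j) x - S c x))\<^sup>2) \<le> ?r"
  proof (cases "j \<le> 2^m")
    case True
    have "ennreal ((cmod (S (c + j) x - S c x))\<^sup>2) \<le> 1 * (block_max c m x + 0)"
      using block_max_upper[OF True] by simp
    also have "\<dots> \<le> ennreal (1 + 1 / (real m + 1)) * (block_max c m x + block_max (c + 2^m) m x)"
      by (intro mult_mono add_mono) (auto simp flip: ennreal_1 intro!: ennreal_leI)
    also have "\<dots> \<le> ?r" by simp
    finally show ?thesis .
  next
    case False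
    define i where "i = j - 2^m"
    have i: "j = 2^m + i" "i \<le> 2^m" using False j by (auto simp: i_def)
    let ?a = "cmod (S (c + 2^m + i) x - S (c + 2^m) x)" and ?b = "cmod (S (c + 2^m) x - S c x)"
    have "cmod (S (c + j) x - S c x) \<le> ?a + ?b"
      using norm_triangle_ineq[of "S (c + 2^m + i) x - S (c + 2^m) x" "S (c + 2^m) x - S c x"]
      by (simp add: i add.assoc)
    then have "(cmod (S (c + j) x - S c x))\<^sup>2 \<le> (?a + ?b)\<^sup>2" by (intro power_mono) auto
    also have "\<dots> \<le> (1 + 1 / (real m + 1)) * ?a\<^sup>2 + (1 + (real m + 1)) * ?b\<^sup>2"
      by (rule square_add_le) simp
    finally have "ennreal ((cmod (S (c + j) x - S c x))\<^sup>2)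
        \<le> ennreal ((1 + 1 / (real m + 1)) * ?a\<^sup>2 + (real m + 2) * ?b\<^sup>2)"
      by (intro ennreal_leI) (simp add: algebra_simps)
    also have "\<dots> = ennreal (1 + 1 / (real m + 1)) * ennreal (?a\<^sup>2) + ennreal (real m + 2) * ennreal (?b\<^sup>2)"
      by (simp add: ennreal_plus ennreal_mult' del: ennreal_plus[symmetric])
    also have "\<dots> \<le> ?r"
      using block_max_upper[OF i(2), of "c + 2^m" x]
      by (intro add_mono mult_left_mono order_refl) (auto intro: add_increasing)
    finally show ?thesis .
  qed
qed

text \<open>With \<open>t = m + 1\<close> the recursion closes exactly:
  \<open>(1 + 1/t) * t^2 + (t + 1) = (t + 1)^2\<close>, so each doubling of the block raises the
  root of the factor by one.\<close>

lemma nn_integral_block_max: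
  "(\<integral>\<^sup>+x. block_max c m x \<partial>M) \<le> ennreal ((real m + 1)\<^sup>2 * (V (c + 2^m) - V c))"
proof (induction m arbitrary: c)
  case 0
  have "block_max c 0 x \<le> ennreal ((cmod (S (c + 1) x - S c x))\<^sup>2)" for x
    unfolding block_max_def by (rule SUP_least) (auto simp: le_Suc_eq)
  then have "(\<integral>\<^sup>+x. block_max c 0 x \<partial>M) \<le> (\<integral>\<^sup>+x. ennreal ((cmod (S (c + 1) x - S c x))\<^sup>2) \<partial>M)"
    by (intro nn_integral_mono) auto
  also have "\<dots> \<le> ennreal (V (c + 1) - V c)" by (rule increment) simp
  finally show ?case by simp
next
  case (Suc m)
  let ?d = "V (c + 2^m) - V c" and ?e = "V (c + 2^m + 2^m) - V (c + 2^m)" and ?t = "real m + 1"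
  have nn: "?d \<ge> 0" "?e \<ge> 0" by (auto intro!: V_mono)
  have "(\<integral>\<^sup>+x. block_max c (Suc m) x \<partial>M) \<le> (\<integral>\<^sup>+x.
      (ennreal (1 + 1 / ?t) * (block_max c m x + block_max (c + 2^m) m x) +
       ennreal (real m + 2) * ennreal ((cmod (S (c + 2^m) x - S c x))\<^sup>2)) \<partial>M)"
    by (intro nn_integral_mono block_max_Suc)
  also have "\<dots> \<le> ennreal ((1 + 1 / ?t) * (?t\<^sup>2 * ?d + ?t\<^sup>2 * ?e) + (real m + 2) * ?d)"
    using nn by (intro nn_integral_add_le nn_integral_cmult_le Suc.IH increment) auto
  also have "\<dots> \<le> ennreal ((real (Suc m) + 1)\<^sup>2 * (?d + ?e))"
  proof (rule ennreal_leI)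
    have "(1 + 1 / ?t) * (?t\<^sup>2 * ?d + ?t\<^sup>2 * ?e) = (?t + 1) * ?t * (?d + ?e)"
      by (simp add: field_simps power2_eq_square)
    moreover have "(real m + 2) * ?d \<le> (real m + 2) * (?d + ?e)" using nn by (intro mult_left_mono) auto
    moreover have "(?t + 1) * ?t * (?d + ?e) + (real m + 2) * (?d + ?e) = (real (Suc m) + 1)\<^sup>2 * (?d + ?e)"
      by (simp add: algebra_simps power2_eq_square)
    ultimately show "(1 + 1 / ?t) * (?t\<^sup>2 * ?d + ?t\<^sup>2 * ?e) + (real m + 2) * ?d
        \<le> (real (Suc m) + 1)\<^sup>2 * (?d + ?e)" by linarith
  qed
  finally show ?case by (simp add: mult_2 add.assoc)
qed

text \<open>Summation by parts: the increment from \<open>v j\<close> to \<open>v (Suc j)\<close>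
  occurs in the tails of all \<open>k \<le> j\<close>, that is \<open>j + 1\<close> times.\<close>

lemma sum_tails:
  fixes v :: "nat \<Rightarrow> real"
  shows "(\<Sum>k<n. v n - v k) = (\<Sum>j<n. (real j + 1) * (v (Suc j) - v j))"
proof (induction n)
  case (Suc n)
  have "(\<Sum>k<Suc n. v (Suc n) - v k) = (\<Sum>k<n. v n - v k) + (real n + 1) * (v (Suc n) - v n)"
    by (simp add: sum_subtractf algebra_simps)
  then show ?case using Suc by simp
qed simp

text \<open>A single block starting at 0 would put the factor \<open>(m + 1)^2\<close> on the whole
  energy, with no control as \<open>m\<close> grows. Starting a block at each power of two attaches
  \<open>(j + 1)^2\<close> only to the energy between \<open>2^j\<close> and \<open>2^Suc j\<close>;
  this is the discrete form of the weight \<open>ln (2 + r)^2\<close>.\<close>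

theorem rademacher_menshov:
  assumes S0: "\<And>x. S 0 x = 0"
  shows "(\<integral>\<^sup>+x. (SUP n\<in>{..2^m}. ennreal ((cmod (S n x))\<^sup>2)) \<partial>M) \<le>
    ennreal (3 * (V (2^m) - V 0) + 6 * (\<Sum>j<m. (real j + 1)\<^sup>2 * (V (2 ^ Suc j) - V (2 ^ j))))"
proof -
  let ?top = "\<lambda>x. ennreal ((cmod (S (2^m) x - S 0 x))\<^sup>2)"
  let ?h = "\<lambda>k x. ennreal 3 * ennreal ((cmod (S (2^m) x - S (2^k) x))\<^sup>2) + ennreal 3 * block_max (2^k) k x"
  let ?u = "\<lambda>k. 3 * (V (2^m) - V (2^k)) + 3 * ((real k + 1)\<^sup>2 * (V (2^k + 2^k) - V (2^k)))"
  have pt: "(SUP n\<in>{..2^m}. ennreal ((cmod (S n x))\<^sup>2)) \<le> ennreal 3 * ?top x + (\<Sum>k<m. ?h k x)" for x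
  proof (rule SUP_least)
    fix n :: nat assume "n \<in> {..2^m}"
    then consider "n = 0" | "n = 2^m" | "0 < n" "n < 2^m" by force
    then show "ennreal ((cmod (S n x))\<^sup>2) \<le> ennreal 3 * ?top x + (\<Sum>k<m. ?h k x)"
    proof cases
      case 2
      have "ennreal ((cmod (S n x))\<^sup>2) \<le> 1 * ?top x" by (simp add: 2 S0)
      also have "\<dots> \<le> ennreal 3 * ?top x" by (intro mult_right_mono) auto
      finally show ?thesis by (simp add: add_increasing2)
    next
      case 3
      obtain k where k: "2^k \<le> n" "n < 2^(k+1)"
        using ex_power_ivl1[of 2 n] 3 by auto
      have "2^k < (2::nat)^m" using k 3 by linarith
      then have km: "k < m" by simp
      define i where "i = n - 2^k"
      have i: "n = 2^k + i" "i \<le> 2^k" using k by (auto simp: i_def)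
      let ?a = "cmod (S (2^m) x - S 0 x)" and ?b = "cmod (S (2^m) x - S (2^k) x)"
        and ?c = "cmod (S (2^k + i) x - S (2^k) x)"
      \<comment> \<open>The start \<open>2^k\<close> of the block is reached from the top index, so
        that the tail energies \<open>V (2^m) - V (2^k)\<close> appear and \<open>sum_tails\<close>
        applies.\<close>
      have "S n x = (S (2^m) x - S 0 x) - (S (2^m) x - S (2^k) x) + (S (2^k + i) x - S (2^k) x)"
        by (simp add: i S0)
      then have "cmod (S n x) \<le> ?a + ?b + ?c"
        by (metis norm_triangle_ineq norm_triangle_ineq4 add_right_mono order_trans)
      then have "(cmod (S n x))\<^sup>2 \<le> (?a + ?b + ?c)\<^sup>2" by (intro power_mono) auto
      also have "\<dots> \<le> 3 * ?a\<^sup>2 + 3 * ?b\<^sup>2 + 3 * ?c\<^sup>2" by (rule square_add3_le)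
      finally have "ennreal ((cmod (S n x))\<^sup>2) \<le> ennreal (3 * ?a\<^sup>2 + 3 * ?b\<^sup>2 + 3 * ?c\<^sup>2)"
        by (rule ennreal_leI)
      also have "\<dots> = ennreal 3 * ?top x + (ennreal 3 * ennreal (?b\<^sup>2) + ennreal 3 * ennreal (?c\<^sup>2))"
        by (simp add: ennreal_plus ennreal_mult' add.assoc del: ennreal_plus[symmetric])
      also have "\<dots> \<le> ennreal 3 * ?top x + ?h k x"
        by (intro add_mono mult_left_mono order_refl block_max_upper[OF i(2)]) auto
      \<comment> \<open>The level \<open>k\<close> depends on \<open>n\<close>; summing all levels
        gives one bound for every \<open>n\<close>.\<close>
      also have "\<dots> \<le> ennreal 3 * ?top x + (\<Sum>k<m. ?h k x)"
        using km by (intro add_mono order_refl member_le_sum) auto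
      finally show ?thesis .
    qed (simp add: S0)
  qed
  have u: "?u k \<ge> 0" if "k < m" for k
    using V_mono[of "2^k" "2^m"] V_mono[of "2^k" "2^k+2^k"] that by simp
  have "(\<integral>\<^sup>+x. (\<Sum>k<m. ?h k x) \<partial>M) = (\<Sum>k<m. (\<integral>\<^sup>+x. ?h k x \<partial>M))"
    by (rule nn_integral_sum) measurable
  also have "\<dots> \<le> (\<Sum>k<m. ennreal (?u k))"
  proof (rule sum_mono)
    fix k assume "k \<in> {..<m}"
    then show "(\<integral>\<^sup>+x. ?h k x \<partial>M) \<le> ennreal (?u k)"
      using V_mono[of "2^k" "2^m"] V_mono[of "2^k" "2^k+2^k"]
      by (intro nn_integral_add_le nn_integral_cmult_le nn_integral_block_max increment) auto
  qed
  also have "\<dots> = ennreal (\<Sum>k<m. ?u k)" using u by (intro sum_ennreal) auto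
  finally have h: "(\<integral>\<^sup>+x. (\<Sum>k<m. ?h k x) \<partial>M) \<le> ennreal (\<Sum>k<m. ?u k)" .
  have "(\<integral>\<^sup>+x. (SUP n\<in>{..2^m}. ennreal ((cmod (S n x))\<^sup>2)) \<partial>M)
      \<le> (\<integral>\<^sup>+x. ennreal 3 * ?top x + (\<Sum>k<m. ?h k x) \<partial>M)"
    by (intro nn_integral_mono pt)
  also have "\<dots> \<le> ennreal (3 * (V (2^m) - V 0) + (\<Sum>k<m. ?u k))"
    using u V_mono[of 0 "2^m"]
    by (intro nn_integral_add_le nn_integral_cmult_le h increment) (auto intro!: sum_nonneg)
  also have "\<dots> \<le> ennreal (3 * (V (2^m) - V 0) + 6 * (\<Sum>j<m. (real j + 1)\<^sup>2 * (V (2 ^ Suc j) - V (2 ^ j))))"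
  proof (intro ennreal_leI add_left_mono)
    let ?d = "\<lambda>j. V (2 ^ Suc j) - V (2 ^ j)"
    have "(\<Sum>k<m. ?u k) = 3 * (\<Sum>k<m. V (2^m) - V (2^k)) + 3 * (\<Sum>k<m. (real k + 1)\<^sup>2 * ?d k)"
      by (simp add: sum.distrib sum_distrib_left mult_2)
    also have "(\<Sum>k<m. V (2^m) - V (2^k)) = (\<Sum>j<m. (real j + 1) * ?d j)"
      by (rule sum_tails[of "\<lambda>k. V (2^k)"])
    also have "\<dots> \<le> (\<Sum>j<m. (real j + 1)\<^sup>2 * ?d j)"
      by (intro sum_mono mult_right_mono) (auto simp: power2_eq_square intro!: V_mono)
    finally show "(\<Sum>k<m. ?u k) \<le> 6 * (\<Sum>j<m. (real j + 1)\<^sup>2 * ?d j)" by simp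
  qed
  finally show ?thesis .
qed

end

section \<open>The Krein system\<close>

lemma absolutely_integrable_mult_continuous:
  fixes f g :: "real \<Rightarrow> complex"
  assumes "f absolutely_integrable_on {a..b}" "continuous_on {a..b} g"
  shows "(\<lambda>x. f x * g x) absolutely_integrable_on {a..b}"
proof -
  have "(\<lambda>x. g x * f x) absolutely_integrable_on {a..b}"
  proof (rule absolutely_integrable_bounded_measurable_product[OF bilinear_times])
    show "bounded (g ` {a..b})"
      using assms(2) by (intro compact_imp_bounded compact_continuous_image) auto
    show "g \<in> borel_measurable (lebesgue_on {a..b})"
      by (rule continuous_imp_measurable_on_sets_lebesgue) (use assms in auto)
  qed (use assms in auto)
  then show ?thesis by (simp add: mult.commute)
qed

text \<open>On a bounded interval \<open>1 + (cmod (f r))^2\<close> is an integrable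
  majorant.\<close>

lemma absolutely_integrable_on_Icc_if_square:
  fixes f :: "real \<Rightarrow> complex"
  assumes "f \<in> borel_measurable (lebesgue_on {0..})"
    and sq: "(\<lambda>r. (cmod (f r))\<^sup>2) absolutely_integrable_on {a..b}" and "0 \<le> a"
  shows "f absolutely_integrable_on {a..b}"
proof (rule measurable_bounded_by_integrable_imp_absolutely_integrable)
  show "f \<in> borel_measurable (lebesgue_on {a..b})"
    by (rule measurable_restrict_mono[OF assms(1)]) (use \<open>0 \<le> a\<close> in auto)
  show "(\<lambda>r. 1 + (cmod (f r))\<^sup>2) integrable_on {a..b}"
    using set_lebesgue_integral_eq_integral(1)[OF sq] by (intro integrable_add integrable_const_ivl)
  show "cmod (f x) \<le> 1 + (cmod (f x))\<^sup>2" if "x \<in> {a..b}" for x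
  proof -
    have "0 \<le> (cmod (f x) - 1)\<^sup>2 + cmod (f x)" by simp
    then show ?thesis using zero_le_power2[of "cmod (f x)"] by (simp add: power2_eq_square algebra_simps)
  qed
qed simp

lemma norm_integral_mult_le:
  fixes f g :: "real \<Rightarrow> complex"
  assumes f: "f absolutely_integrable_on {a..b}" and g: "continuous_on {a..b} g"
    and M: "\<And>x. x \<in> {a..b} \<Longrightarrow> cmod (g x) \<le> M"
  shows "cmod (integral {a..b} (\<lambda>x. f x * g x)) \<le> M * integral {a..b} (\<lambda>x. cmod (f x))"
proof -
  have nf: "(\<lambda>x. cmod (f x)) integrable_on {a..b}"
    using f by (simp add: absolutely_integrable_on_def)
  have "cmod (integral {a..b} (\<lambda>x. f x * g x)) \<le> integral {a..b} (\<lambda>x. M * cmod (f x))"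
  proof (rule integral_norm_bound_integral)
    show "(\<lambda>x. f x * g x) integrable_on {a..b}"
      using absolutely_integrable_mult_continuous[OF f g] by (simp add: absolutely_integrable_on_def)
    show "(\<lambda>x. M * cmod (f x)) integrable_on {a..b}" using nf by (rule integrable_on_mult_right)
    show "cmod (f x * g x) \<le> M * cmod (f x)" if "x \<in> {a..b}" for x
      using mult_right_mono[OF M[OF that] norm_ge_zero[of "f x"]]
      by (simp add: norm_mult mult.commute)
  qed
  then show ?thesis by simp
qed

lemma L2_loc_half_line_square:
  assumes "L2_loc_half_line A" "0 \<le> a"
  shows "(\<lambda>r. (cmod (A r))\<^sup>2) absolutely_integrable_on {a..b}"
proof -
  have "integrable (lebesgue_on {0..max b 1}) (\<lambda>r. (cmod (A r))\<^sup>2)"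
    using assms unfolding L2_loc_half_line_def by auto
  then have "(\<lambda>r. (cmod (A r))\<^sup>2) absolutely_integrable_on {0..max b 1}"
    by (simp add: integrable_restrict_space set_integrable_def)
  then show ?thesis
    by (rule absolutely_integrable_on_subinterval) (use assms in auto)
qed

lemma L2_half_line_imp_loc: "L2_half_line f \<Longrightarrow> L2_loc_half_line f"
  unfolding L2_half_line_def L2_loc_half_line_def
proof (intro conjI allI impI; elim conjE)
  fix a :: real assume "integrable (lebesgue_on {0..}) (\<lambda>r. (cmod (f r))\<^sup>2)"
  then have "set_integrable lebesgue {0..} (\<lambda>r. (cmod (f r))\<^sup>2)"
    by (simp add: integrable_restrict_space set_integrable_def)
  then have "set_integrable lebesgue {0..a} (\<lambda>r. (cmod (f r))\<^sup>2)"
    by (rule set_integrable_subset) auto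
  then show "integrable (lebesgue_on {0..a}) (\<lambda>r. (cmod (f r))\<^sup>2)"
    by (simp add: integrable_restrict_space set_integrable_def)
qed

lemma L2_loc_half_line_abs:
  "L2_loc_half_line f \<Longrightarrow> 0 \<le> a \<Longrightarrow> f absolutely_integrable_on {a..b}"
  by (intro absolutely_integrable_on_Icc_if_square L2_loc_half_line_square)
     (simp_all add: L2_loc_half_line_def)

lemma nn_integral_cmod_square:
  fixes f :: "real \<Rightarrow> complex"
  assumes "(\<lambda>r. (cmod (f r))\<^sup>2) integrable_on S"
  shows "(\<integral>\<^sup>+r\<in>S. ennreal ((cmod (f r))\<^sup>2) \<partial>lebesgue) = ennreal (integral S (\<lambda>r. (cmod (f r))\<^sup>2))"
  unfolding nn_integral_completion
  by (rule nn_integral_has_integral_lebesgue'[OF _ integrable_integral[OF assms]]) simp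

locale krein =
  fixes A :: "real \<Rightarrow> complex" and P Pstar :: "real \<Rightarrow> complex \<Rightarrow> complex" and \<sigma> :: "real measure"
  assumes system: "krein_system A P Pstar"
    and orthogonality: "orthogonality_measure P \<sigma>"
    and stummel: "stummel_class A"
begin

lemma L2_loc_A: "L2_loc_half_line A"
  using stummel by (simp add: stummel_class_def)

lemmas A_abs = L2_loc_half_line_abs[OF L2_loc_A]

lemma initial [simp]: "P 0 k = 1" "Pstar 0 k = 1"
  using system by (auto simp: krein_system_def)

lemma abs_cont:
  assumes "0 \<le> a"
  shows "abs_cont_on a b (\<lambda>r. P r k)" "abs_cont_on a b (\<lambda>r. Pstar r k)"
proof -
  have "abs_cont_on 0 (max b 1) (\<lambda>r. P r k)" "abs_cont_on 0 (max b 1) (\<lambda>r. Pstar r k)"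
    using system by (auto simp: krein_system_def)
  then show "abs_cont_on a b (\<lambda>r. P r k)" "abs_cont_on a b (\<lambda>r. Pstar r k)"
    using assms by (auto elim!: abs_cont_on_subset)
qed

lemma cont:
  assumes "0 \<le> a"
  shows "continuous_on {a..b} (\<lambda>r. P r k)" "continuous_on {a..b} (\<lambda>r. Pstar r k)"
  using abs_cont[OF assms] by (auto intro: abs_cont_on_imp_continuous_on)

lemma derivative:
  "AE r in lebesgue. 0 < r \<longrightarrow>
     ((\<lambda>s. P s k) has_vector_derivative (\<i> * k * P r k - cnj (A r) * Pstar r k)) (at r) \<and>
     ((\<lambda>s. Pstar s k) has_vector_derivative (- A r * P r k)) (at r)"
  using system by (auto simp: krein_system_def)

lemma cnj_A_abs: "0 \<le> a \<Longrightarrow> (\<lambda>r. cnj (A r)) absolutely_integrable_on {a..b}"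
  using absolutely_integrable_linear[OF A_abs bounded_linear_cnj] by (simp add: o_def)

lemma Pstar_increment:
  assumes "0 \<le> a" "a \<le> b"
  shows "Pstar b k - Pstar a k = - integral {a..b} (\<lambda>r. A r * P r k)"
proof -
  have h: "((\<lambda>r. - A r * P r k) has_integral (Pstar b k - Pstar a k)) {a..b}"
    by (rule abs_cont_on_has_integral[OF abs_cont(2)[OF assms(1)] assms(2)])
       (use derivative[of k] assms in \<open>auto elim!: eventually_mono\<close>)
  from has_integral_neg[OF h] have "((\<lambda>r. A r * P r k) has_integral - (Pstar b k - Pstar a k)) {a..b}"
    by simp
  then show ?thesis by (simp add: integral_unique)
qed

lemma P_increment:
  assumes "0 \<le> a" "a \<le> b"
  shows "((\<lambda>r. \<i> * k * P r k - cnj (A r) * Pstar r k) has_integral (P b k - P a k)) {a..b}"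
  by (rule abs_cont_on_has_integral[OF abs_cont(1)[OF assms(1)] assms(2)])
     (use derivative[of k] assms in \<open>auto elim!: eventually_mono\<close>)

text \<open>For real \<open>k\<close> the difference of the squared moduli has vanishing derivative.\<close>

lemma cmod_Pstar:
  assumes "0 \<le> r"
  shows "cmod (Pstar r (complex_of_real k)) = cmod (P r (complex_of_real k))"
proof -
  let ?k = "complex_of_real k"
  let ?h = "\<lambda>s. P s ?k * cnj (P s ?k) - Pstar s ?k * cnj (Pstar s ?k)"
  have "((\<lambda>s. 0) has_integral (?h r - ?h 0)) {0..r}"
  proof (rule abs_cont_on_has_integral[OF _ assms])
    show "abs_cont_on 0 r ?h"
      by (intro abs_cont_on_diff abs_cont_on_mult abs_cont_on_cnj abs_cont) simp_all
    show "AE x in lebesgue. 0 < x \<and> x < r \<longrightarrow> (?h has_vector_derivative 0) (at x)"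
      using derivative[of ?k]
    proof (rule eventually_mono, intro impI)
      fix x
      assume "0 < x \<longrightarrow>
         ((\<lambda>s. P s ?k) has_vector_derivative (\<i> * ?k * P x ?k - cnj (A x) * Pstar x ?k)) (at x) \<and>
         ((\<lambda>s. Pstar s ?k) has_vector_derivative (- A x * P x ?k)) (at x)" and "0 < x \<and> x < r"
      then have d: "((\<lambda>s. P s ?k) has_vector_derivative (\<i> * ?k * P x ?k - cnj (A x) * Pstar x ?k)) (at x)"
         "((\<lambda>s. Pstar s ?k) has_vector_derivative (- A x * P x ?k)) (at x)" by auto
      note c = d[THEN has_vector_derivative_cnj]
      \<comment> \<open>For real \<open>k\<close> the term \<open>\<i> * k\<close> and its conjugate
        cancel in the derivative of \<open>P * cnj P\<close>. The two coefficient terms that remain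
        equal the derivative of \<open>Pstar * cnj Pstar\<close>.\<close>
      show "(?h has_vector_derivative 0) (at x)"
        by (rule has_vector_derivative_eq_rhs[OF has_vector_derivative_diff[OF
              has_vector_derivative_mult[OF d(1) c(1)] has_vector_derivative_mult[OF d(2) c(2)]]])
           (simp add: algebra_simps)
    qed
  qed
  then have "?h r = 0" using has_integral_unique[OF _ has_integral_0] by force
  then have "P r ?k * cnj (P r ?k) = Pstar r ?k * cnj (Pstar r ?k)" by simp
  then have "(cmod (P r ?k))\<^sup>2 = (cmod (Pstar r ?k))\<^sup>2"
    by (metis complex_norm_square of_real_eq_iff)
  then show ?thesis by simp
qed

section \<open>Step length and growth of P within one step\<close>

definition m :: nat where "m = nat \<lceil>16 * (1 + (stummel_norm A)\<^sup>2)\<rceil>"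
text \<open>The step is the reciprocal of an integer, so that exactly \<open>m\<close> steps fill a
  unit interval. The factor 16 in \<open>m\<close> gives
  \<open>\<delta> \<le> 1 / (16 * (1 + (stummel_norm A)^2))\<close>, which is what makes
  \<open>integral_A_le\<close> come out at \<open>1/4\<close>.\<close>

definition \<delta> :: real where "\<delta> = 1 / real m"

lemma m_bounds: "16 * (1 + (stummel_norm A)\<^sup>2) \<le> real m" "real m \<le> 17 * (1 + (stummel_norm A)\<^sup>2)"
proof -
  define x where "x = 16 * (1 + (stummel_norm A)\<^sup>2)"
  have "x \<ge> 16" by (simp add: x_def)
  then have "real m = of_int \<lceil>x\<rceil>" unfolding m_def x_def[symmetric] by simp
  \<comment> \<open>Rounding up adds at most 1, and \<open>1 \<le> x / 16\<close>.\<close>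
  then have "x \<le> real m" "real m \<le> 17 / 16 * x" using \<open>x \<ge> 16\<close> by linarith+
  then show "16 * (1 + (stummel_norm A)\<^sup>2) \<le> real m" "real m \<le> 17 * (1 + (stummel_norm A)\<^sup>2)"
    unfolding x_def by simp_all
qed

lemma m_ge: "m \<ge> 16"
proof -
  have "16 * 1 \<le> 16 * (1 + (stummel_norm A)\<^sup>2)" by (intro mult_left_mono) auto
  also note m_bounds(1)
  finally show ?thesis by simp
qed

lemma \<delta>_pos: "\<delta> > 0" and \<delta>_le_1: "\<delta> \<le> 1" and m_\<delta>: "real m * \<delta> = 1"
  using m_ge by (auto simp: \<delta>_def)

lemma square_integral_A:
  assumes "0 \<le> r"
  shows "integral {r..r+1} (\<lambda>s. (cmod (A s))\<^sup>2) \<le> (stummel_norm A)\<^sup>2"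
proof -
  have "local_L2_norm A r \<le> stummel_norm A"
    unfolding stummel_norm_def using stummel assms
    by (intro cSUP_upper) (auto simp: stummel_class_def)
  moreover have "local_L2_norm A r = sqrt (integral {r..r+1} (\<lambda>s. (cmod (A s))\<^sup>2))"
    unfolding local_L2_norm_def
    using set_lebesgue_integral_eq_integral(2)[OF L2_loc_half_line_square[OF L2_loc_A assms]] by simp
  moreover have "0 \<le> integral {r..r+1} (\<lambda>s. (cmod (A s))\<^sup>2)"
    by (rule Henstock_Kurzweil_Integration.integral_nonneg)
       (use set_lebesgue_integral_eq_integral(1)[OF L2_loc_half_line_square[OF L2_loc_A assms]] in auto)
  ultimately show ?thesis by (metis real_sqrt_le_iff real_sqrt_pow2_iff power_mono real_sqrt_ge_zero)
qed

text \<open>With \<open>q = 1 + (stummel_norm A)^2\<close>, the pointwise inequality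
  \<open>cmod (A x) \<le> (cmod (A x))^2 / (8 * q) + 2 * q\<close> replaces Cauchy-Schwarz. The
  first term integrates to at most \<open>1/8\<close> because the energy on a unit interval is at
  most \<open>q\<close>, the second because \<open>\<delta> \<le> 1 / (16 * q)\<close>.\<close>

lemma integral_A_le:
  assumes "0 \<le> r" "r \<le> s" "s \<le> r + \<delta>"
  shows "integral {r..s} (\<lambda>x. cmod (A x)) \<le> 1/4"
proof -
  define q where "q = 1 + (stummel_norm A)\<^sup>2"
  have q: "q \<ge> 1" by (simp add: q_def)
  have A2: "(\<lambda>s. (cmod (A s))\<^sup>2) integrable_on {a..b}" if "0 \<le> a" for a b
    using set_lebesgue_integral_eq_integral(1)[OF L2_loc_half_line_square[OF L2_loc_A that]] .
  have "integral {r..s} (\<lambda>x. (cmod (A x))\<^sup>2) \<le> integral {r..r+1} (\<lambda>x. (cmod (A x))\<^sup>2)"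
    using assms \<delta>_le_1 by (intro integral_subset_le A2) auto
  also have "\<dots> \<le> q" using square_integral_A[OF assms(1)] by (simp add: q_def)
  finally have I: "integral {r..s} (\<lambda>x. (cmod (A x))\<^sup>2) \<le> q" .
  have "integral {r..s} (\<lambda>x. cmod (A x)) \<le> integral {r..s} (\<lambda>x. 1 / (8 * q) * (cmod (A x))\<^sup>2 + 2 * q)"
  proof (rule integral_le)
    show "(\<lambda>x. cmod (A x)) integrable_on {r..s}"
      using A_abs[OF assms(1)] by (simp add: absolutely_integrable_on_def)
    show "(\<lambda>x. 1 / (8 * q) * (cmod (A x))\<^sup>2 + 2 * q) integrable_on {r..s}"
      using A2[OF assms(1)] by (intro integrable_add integrable_on_mult_right integrable_const_ivl)
    show "cmod (A x) \<le> 1 / (8 * q) * (cmod (A x))\<^sup>2 + 2 * q" for x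
    proof -
      have "0 \<le> (cmod (A x) - 4 * q)\<^sup>2 / (8 * q)" using q by simp
      then show ?thesis using q by (simp add: power2_eq_square field_simps)
    qed
  qed
  also have "\<dots> = 1 / (8 * q) * integral {r..s} (\<lambda>x. (cmod (A x))\<^sup>2) + 2 * q * (s - r)"
  proof -
    have i: "(\<lambda>x. 1 / (8 * q) * (cmod (A x))\<^sup>2) integrable_on {r..s}"
      by (intro integrable_on_mult_right A2 assms)
    show ?thesis
      by (subst integral_add[OF i integrable_const_ivl]) (use assms(2) in simp)
  qed
  also have "\<dots> \<le> 1 / (8 * q) * q + 2 * q * \<delta>"
    using q I assms by (intro add_mono mult_left_mono) auto
  also have "\<dots> \<le> 1/4"
    using m_bounds(1) q m_ge unfolding \<delta>_def q_def[symmetric] by (simp add: field_simps)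
  finally show ?thesis .
qed

text \<open>The equation for \<open>Pstar\<close> has no term in \<open>k\<close>, which makes the
  bound uniform in \<open>k\<close>; equality of the moduli carries it back to \<open>P\<close>. At
  the point where \<open>cmod P\<close> is largest, the integral is at most a quarter of the
  maximum, so three quarters of the maximum are at most the modulus at \<open>r\<close>.\<close>

lemma cmod_P_le:
  assumes "0 \<le> r" "r \<le> s" "s \<le> r + \<delta>"
  shows "cmod (P s (complex_of_real k)) \<le> 2 * cmod (P r (complex_of_real k))"
proof -
  let ?k = "complex_of_real k"
  have "\<exists>x\<in>{r..s}. \<forall>y\<in>{r..s}. cmod (P y ?k) \<le> cmod (P x ?k)"
    using assms by (intro continuous_attains_sup continuous_intros cont) auto
  then obtain x where x: "x \<in> {r..s}" "\<And>y. y \<in> {r..s} \<Longrightarrow> cmod (P y ?k) \<le> cmod (P x ?k)" by blast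
  have "cmod (Pstar x ?k - Pstar r ?k) = cmod (integral {r..x} (\<lambda>r. A r * P r ?k))"
    using assms x by (subst Pstar_increment) auto
  also have "\<dots> \<le> cmod (P x ?k) * integral {r..x} (\<lambda>r. cmod (A r))"
    using assms x by (intro norm_integral_mult_le A_abs cont) auto
  also have "\<dots> \<le> cmod (P x ?k) * (1/4)"
    using assms x by (intro mult_left_mono integral_A_le) auto
  finally have "cmod (Pstar x ?k) \<le> cmod (Pstar r ?k) + cmod (P x ?k) * (1/4)"
    using norm_triangle_ineq2[of "Pstar x ?k" "Pstar r ?k"] by linarith
  moreover have "cmod (Pstar x ?k) = cmod (P x ?k)" "cmod (Pstar r ?k) = cmod (P r ?k)"
    using assms x by (auto intro!: cmod_Pstar)
  ultimately have "cmod (P x ?k) \<le> 2 * cmod (P r ?k)"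
    using norm_ge_zero[of "P x ?k"] by linarith
  then show ?thesis using x(2)[of s] assms by simp
qed

end

section \<open>Partial integrals and the isometry on arbitrary intervals\<close>

lemma continuous_imp_L2_loc_half_line:
  assumes "continuous_on {0..} f"
  shows "L2_loc_half_line f"
  unfolding L2_loc_half_line_def
proof (intro conjI allI impI)
  show "f \<in> borel_measurable (lebesgue_on {0..})"
    by (rule continuous_imp_measurable_on_sets_lebesgue[OF assms]) auto
  fix a :: real
  have "continuous_on {0..a} (\<lambda>r. (cmod (f r))\<^sup>2)"
    by (intro continuous_intros continuous_on_subset[OF assms]) auto
  then show "integrable (lebesgue_on {0..a}) (\<lambda>r. (cmod (f r))\<^sup>2)"
    by (intro absolutely_integrable_imp_integrable absolutely_integrable_continuous_real) auto
qed

lemma L2_half_line_cut: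
  assumes f: "L2_loc_half_line f" and "0 \<le> a"
  shows "L2_half_line (\<lambda>s. if s \<in> {a..b} then f s else 0)"
proof -
  let ?g = "\<lambda>s. if s \<in> {a..b} then f s else 0"
  have "(\<lambda>s. if s \<in> {a..b} then (cmod (f s))\<^sup>2 else 0) absolutely_integrable_on UNIV"
    unfolding absolutely_integrable_restrict_UNIV by (rule L2_loc_half_line_square[OF assms])
  moreover have "(\<lambda>s. if s \<in> {a..b} then (cmod (f s))\<^sup>2 else 0) = (\<lambda>s. (cmod (?g s))\<^sup>2)" by auto
  ultimately have "(\<lambda>s. (cmod (?g s))\<^sup>2) absolutely_integrable_on UNIV" by simp
  then have "(\<lambda>s. (cmod (?g s))\<^sup>2) absolutely_integrable_on {0..}"
    by (rule set_integrable_subset) auto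
  moreover have "?g absolutely_integrable_on UNIV"
    unfolding absolutely_integrable_restrict_UNIV by (rule L2_loc_half_line_abs[OF assms])
  then have "?g \<in> borel_measurable (lebesgue_on UNIV)"
    by (rule absolutely_integrable_imp_borel_measurable) simp
  then have "?g \<in> borel_measurable lebesgue" by simp
  ultimately show ?thesis
    unfolding L2_half_line_def
    by (auto simp: integrable_restrict_space set_integrable_def intro: measurable_restrict_space1)
qed

context krein
begin

definition partial :: "(real \<Rightarrow> complex) \<Rightarrow> real \<Rightarrow> real \<Rightarrow> real \<Rightarrow> complex" where
  "partial f a b k = integral {a..b} (\<lambda>s. f s * P s (complex_of_real k))"

lemma mult_P_abs:
  "L2_loc_half_line f \<Longrightarrow> 0 \<le> a \<Longrightarrow> (\<lambda>s. f s * P s k) absolutely_integrable_on {a..b}"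
  by (intro absolutely_integrable_mult_continuous L2_loc_half_line_abs cont)

lemma krein_transform_eq_partial:
  "L2_loc_half_line f \<Longrightarrow> krein_transform P f t k = partial f 0 t k"
  unfolding krein_transform_def partial_def
  by (rule set_lebesgue_integral_eq_integral(2)) (rule mult_P_abs, simp_all)

lemma partial_combine:
  assumes "L2_loc_half_line f" "0 \<le> a" "a \<le> b" "b \<le> c"
  shows "partial f a c k = partial f a b k + partial f b c k"
  unfolding partial_def using assms mult_P_abs[OF assms(1,2)]
  by (subst Henstock_Kurzweil_Integration.integral_combine[of a b c, symmetric])
     (auto simp: absolutely_integrable_on_def)

lemma sets_\<sigma>: "sets \<sigma> = sets borel"
  using orthogonality by (simp add: orthogonality_measure_def)

lemma plancherel:
  "L2_half_line f \<Longrightarrow> a > 0 \<Longrightarrow>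
    (\<integral>\<^sup>+k. ennreal ((cmod (krein_transform P f a k))\<^sup>2) \<partial>\<sigma>) =
    (\<integral>\<^sup>+r\<in>{0..a}. ennreal ((cmod (f r))\<^sup>2) \<partial>lebesgue)"
  using orthogonality unfolding orthogonality_measure_def by blast

text \<open>The identity is given on \<open>[0, b]\<close> for square integrable functions. Cutting
  \<open>f\<close> to \<open>[a, b]\<close> carries it over to that interval, and to functions that
  are only locally square integrable, such as the constant 1.\<close>

theorem isometry:
  assumes f: "L2_loc_half_line f" and "0 \<le> a" "a \<le> b"
  shows "(\<integral>\<^sup>+k. ennreal ((cmod (partial f a b k))\<^sup>2) \<partial>\<sigma>) = ennreal (integral {a..b} (\<lambda>r. (cmod (f r))\<^sup>2))"
proof (cases "a = b")
  case True
  then show ?thesis by (simp add: partial_def)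
next
  case False
  then have "b > 0" using assms by simp
  let ?g = "\<lambda>s. if s \<in> {a..b} then f s else 0"
  have g: "L2_half_line ?g" by (rule L2_half_line_cut[OF f \<open>0 \<le> a\<close>])
  have "krein_transform P ?g b k = partial f a b k" for k
  proof -
    have "krein_transform P ?g b k = integral {0..b} (\<lambda>s. if s \<in> {a..b} then f s * P s (complex_of_real k) else 0)"
      unfolding krein_transform_eq_partial[OF L2_half_line_imp_loc[OF g]] partial_def
      by (intro integral_cong) auto
    also have "\<dots> = partial f a b k"
      unfolding partial_def integral_restrict_Int using \<open>0 \<le> a\<close> by (simp add: max_absorb1)
    finally show ?thesis .
  qed
  note eq = this
  have "(\<integral>\<^sup>+k. ennreal ((cmod (partial f a b k))\<^sup>2) \<partial>\<sigma>)
      = (\<integral>\<^sup>+r\<in>{0..b}. ennreal ((cmod (?g r))\<^sup>2) \<partial>lebesgue)"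
    using plancherel[OF g \<open>b > 0\<close>] unfolding eq .
  also have "\<dots> = (\<integral>\<^sup>+r\<in>{a..b}. ennreal ((cmod (f r))\<^sup>2) \<partial>lebesgue)"
    using \<open>0 \<le> a\<close> by (intro nn_integral_cong) (auto simp: indicator_def)
  also have "\<dots> = ennreal (integral {a..b} (\<lambda>r. (cmod (f r))\<^sup>2))"
    by (intro nn_integral_cmod_square set_lebesgue_integral_eq_integral(1) L2_loc_half_line_square[OF f \<open>0 \<le> a\<close>])
  finally show ?thesis .
qed

section \<open>Dependence on the real parameter k: continuity and measurability\<close>

definition gap :: "real \<Rightarrow> real \<Rightarrow> real \<Rightarrow> real" where
  "gap k k' r = cmod (P r (complex_of_real k') - P r (complex_of_real k)) +
     cmod (Pstar r (complex_of_real k') - Pstar r (complex_of_real k))"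

lemma le_gap:
  "cmod (P r (complex_of_real k') - P r (complex_of_real k)) \<le> gap k k' r"
  "cmod (Pstar r (complex_of_real k') - Pstar r (complex_of_real k)) \<le> gap k k' r"
  by (simp_all add: gap_def)

text \<open>A Gronwall step by maximisation; both components are measured together because the
  system couples them. If \<open>M\<close> is the largest gap, the term with \<open>k'\<close> and
  the coefficient terms of the two equations contribute at most \<open>M / 4\<close> each, and
  absorbing \<open>3/4 * M\<close> costs the factor 4. The source term is the mismatch
  \<open>k' - k\<close> acting on \<open>P\<close>.\<close>

lemma gap_step:
  assumes ab: "0 \<le> a" "a \<le> b" "b \<le> a + \<delta>" and small: "(\<bar>k\<bar> + 1) * (b - a) \<le> 1/4"
    and B: "0 \<le> B" "\<And>s. s \<in> {a..b} \<Longrightarrow> cmod (P s (complex_of_real k)) \<le> B"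
    and k': "\<bar>k' - k\<bar> \<le> 1" and s: "s \<in> {a..b}"
  shows "gap k k' s \<le> 4 * gap k k' a + 4 * B * \<bar>k' - k\<bar>"
proof -
  let ?p = "\<lambda>r. P r (complex_of_real k)" and ?p' = "\<lambda>r. P r (complex_of_real k')"
  let ?q = "\<lambda>r. Pstar r (complex_of_real k)" and ?q' = "\<lambda>r. Pstar r (complex_of_real k')"
  have "\<exists>x\<in>{a..b}. \<forall>y\<in>{a..b}. gap k k' y \<le> gap k k' x"
    unfolding gap_def using ab by (intro continuous_attains_sup continuous_intros cont) auto
  then obtain x where x: "x \<in> {a..b}" "\<And>y. y \<in> {a..b} \<Longrightarrow> gap k k' y \<le> gap k k' x" by blast
  have ax: "a \<le> x" "x \<le> b" using x by auto
  define M where "M = gap k k' x"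
  have M0: "0 \<le> M" by (simp add: M_def gap_def)
  have Mp: "cmod (?p' y - ?p y) \<le> M" and Mq: "cmod (?q' y - ?q y) \<le> M" if "y \<in> {a..x}" for y
    using x(2)[of y] that ax le_gap[of y k' k] unfolding M_def by auto
  let ?g = "\<lambda>r. \<i> * complex_of_real k' * ?p' r - \<i> * complex_of_real k * ?p r"
  let ?h = "\<lambda>r. cnj (A r) * (?q' r - ?q r)"
  have "((\<lambda>r. (\<i> * complex_of_real k' * ?p' r - cnj (A r) * ?q' r) - (\<i> * complex_of_real k * ?p r - cnj (A r) * ?q r))
      has_integral ((?p' x - ?p' a) - (?p x - ?p a))) {a..x}"
    by (intro has_integral_diff P_increment ab ax)
  moreover have "(\<lambda>r. (\<i> * complex_of_real k' * ?p' r - cnj (A r) * ?q' r) - (\<i> * complex_of_real k * ?p r - cnj (A r) * ?q r))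
      = (\<lambda>r. ?g r - ?h r)"
    by (auto simp: algebra_simps)
  ultimately have "integral {a..x} (\<lambda>r. ?g r - ?h r) = (?p' x - ?p' a) - (?p x - ?p a)"
    by (simp add: integral_unique)
  moreover have gi: "continuous_on {a..x} ?g" by (intro continuous_intros cont ab)
  moreover have hi: "?h integrable_on {a..x}"
    by (intro set_lebesgue_integral_eq_integral(1) absolutely_integrable_mult_continuous
        cnj_A_abs continuous_intros cont ab)
  ultimately have "(?p' x - ?p' a) - (?p x - ?p a) = integral {a..x} ?g - integral {a..x} ?h"
    by (subst integral_diff[symmetric]) (auto intro: integrable_continuous_real)
  then have "?p' x - ?p x = (?p' a - ?p a) + integral {a..x} ?g - integral {a..x} ?h"
    by (simp add: algebra_simps)
  then have "cmod (?p' x - ?p x) \<le> cmod (?p' a - ?p a) + cmod (integral {a..x} ?g) + cmod (integral {a..x} ?h)"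
    using norm_triangle_ineq4[of "(?p' a - ?p a) + integral {a..x} ?g" "integral {a..x} ?h"]
      norm_triangle_ineq[of "?p' a - ?p a" "integral {a..x} ?g"] by simp
  moreover have "cmod (integral {a..x} ?g) \<le> ((\<bar>k\<bar> + 1) * M + B * \<bar>k' - k\<bar>) * (x - a)"
  proof (rule integral_bound[OF ax(1) gi])
    fix y assume y: "y \<in> {a..x}"
    \<comment> \<open>Only the first summand involves the gap; its factor
      \<open>\<bar>k'\<bar>\<close> is at most \<open>\<bar>k\<bar> + 1\<close>, which the
      assumption \<open>small\<close> controls.\<close>
    have "?g y = \<i> * complex_of_real k' * (?p' y - ?p y) + \<i> * complex_of_real (k' - k) * ?p y"
      by (simp add: algebra_simps)
    then have "cmod (?g y) \<le> \<bar>k'\<bar> * cmod (?p' y - ?p y) + \<bar>k' - k\<bar> * cmod (?p y)"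
      using norm_triangle_ineq[of "\<i> * complex_of_real k' * (?p' y - ?p y)" "\<i> * complex_of_real (k' - k) * ?p y"]
      by (simp only: norm_mult norm_of_real norm_ii mult_1)
    also have "\<dots> \<le> (\<bar>k\<bar> + 1) * M + \<bar>k' - k\<bar> * B"
      using k' y ax by (intro add_mono mult_mono Mp B) auto
    finally show "cmod (?g y) \<le> (\<bar>k\<bar> + 1) * M + B * \<bar>k' - k\<bar>" by (simp add: mult.commute)
  qed
  moreover have "((\<bar>k\<bar> + 1) * M + B * \<bar>k' - k\<bar>) * (x - a) \<le> 1/4 * M + B * \<bar>k' - k\<bar>"
  proof -
    have "(\<bar>k\<bar> + 1) * (x - a) \<le> (\<bar>k\<bar> + 1) * (b - a)" using ax by (intro mult_left_mono) auto
    then have "(\<bar>k\<bar> + 1) * (x - a) * M \<le> 1/4 * M" using small M0 by (intro mult_right_mono) auto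
    moreover have "B * \<bar>k' - k\<bar> * (x - a) \<le> B * \<bar>k' - k\<bar> * 1"
      using ax ab \<delta>_le_1 B(1) by (intro mult_left_mono) auto
    ultimately show ?thesis by (simp add: algebra_simps)
  qed
  moreover have IA: "integral {a..x} (\<lambda>r. cmod (A r)) \<le> 1/4"
    using ab ax by (intro integral_A_le) auto
  have "cmod (integral {a..x} ?h) \<le> M * integral {a..x} (\<lambda>r. cmod (cnj (A r)))"
    by (intro norm_integral_mult_le cnj_A_abs continuous_intros cont ab Mq)
  moreover have "M * integral {a..x} (\<lambda>r. cmod (cnj (A r))) \<le> M * (1/4)"
    using IA M0 by (intro mult_left_mono) auto
  moreover have "cmod (?q' x - ?q x) \<le> cmod (?q' a - ?q a) + M * (1/4)"
  proof -
    let ?u = "\<lambda>r. A r * (?p' r - ?p r)"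
    have iu: "integral {a..x} ?u = integral {a..x} (\<lambda>r. A r * ?p' r) - integral {a..x} (\<lambda>r. A r * ?p r)"
      unfolding right_diff_distrib
      by (intro integral_diff set_lebesgue_integral_eq_integral(1) mult_P_abs L2_loc_A ab)
    have "?q' x - ?q x = (?q' a - ?q a) - integral {a..x} ?u"
      unfolding iu using Pstar_increment[OF ab(1) ax(1), of "complex_of_real k'"]
        Pstar_increment[OF ab(1) ax(1), of "complex_of_real k"] by algebra
    then have "cmod (?q' x - ?q x) \<le> cmod (?q' a - ?q a) + cmod (integral {a..x} ?u)"
      using norm_triangle_ineq4 by metis
    also have "cmod (integral {a..x} ?u) \<le> M * integral {a..x} (\<lambda>r. cmod (A r))"
      by (intro norm_integral_mult_le A_abs continuous_intros cont ab Mp)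
    also have "\<dots> \<le> M * (1/4)" using IA M0 by (intro mult_left_mono)
    finally show ?thesis by simp
  qed
  moreover have "M = cmod (?p' x - ?p x) + cmod (?q' x - ?q x)" by (simp add: M_def gap_def)
  ultimately have "M \<le> gap k k' a + 3/4 * M + B * \<bar>k' - k\<bar>"
    unfolding gap_def[of k k' a] by linarith
  then have "M \<le> 4 * gap k k' a + 4 * B * \<bar>k' - k\<bar>" by simp
  then show ?thesis using x(2)[OF s] by (simp add: M_def)
qed

text \<open>Steps of a length adapted to \<open>k\<close> cover \<open>[0, R]\<close>. The constant
  grows with every step, but it depends on \<open>k\<close> and \<open>R\<close> alone, and
  continuity at a fixed \<open>k\<close> asks for no more.\<close>

lemma gap_bound:
  "\<exists>c\<ge>0. \<forall>k' r. \<bar>k' - k\<bar> \<le> 1 \<longrightarrow> 0 \<le> r \<longrightarrow> r \<le> R \<longrightarrow> gap k k' r \<le> c * \<bar>k' - k\<bar>"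
proof -
  \<comment> \<open>The bound by \<open>\<delta>\<close> serves the coefficient terms, the other one
    the term with \<open>k\<close>.\<close>
  define \<eta> where "\<eta> = min \<delta> (1 / (4 * (\<bar>k\<bar> + 1)))"
  have \<eta>: "\<eta> > 0" "\<eta> \<le> \<delta>" using \<delta>_pos by (auto simp: \<eta>_def)
  have "(\<bar>k\<bar> + 1) * \<eta> \<le> (\<bar>k\<bar> + 1) * (1 / (4 * (\<bar>k\<bar> + 1)))"
    by (intro mult_left_mono) (auto simp: \<eta>_def)
  also have "\<dots> = 1/4"
  proof -
    have "\<bar>k\<bar> + 1 \<noteq> 0" by linarith
    then show ?thesis by (simp add: field_simps)
  qed
  finally have k\<eta>: "(\<bar>k\<bar> + 1) * \<eta> \<le> 1/4" .
  have "\<exists>c\<ge>0. \<forall>k' r. \<bar>k' - k\<bar> \<le> 1 \<longrightarrow> 0 \<le> r \<longrightarrow> r \<le> real n * \<eta> \<longrightarrow> gap k k' r \<le> c * \<bar>k' - k\<bar>" for n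
  proof (induction n)
    case 0
    then show ?case by (auto simp: gap_def)
  next
    case (Suc n)
    then obtain c where c: "c \<ge> 0" "\<And>k' r. \<bar>k' - k\<bar> \<le> 1 \<Longrightarrow> 0 \<le> r \<Longrightarrow> r \<le> real n * \<eta> \<Longrightarrow> gap k k' r \<le> c * \<bar>k' - k\<bar>"
      by blast
    let ?a = "real n * \<eta>"
    have a0: "0 \<le> ?a" using \<eta> by simp
    have "bounded ((\<lambda>s. P s (complex_of_real k)) ` {?a..?a + \<eta>})"
      by (intro compact_imp_bounded compact_continuous_image cont a0) simp
    then obtain B where B: "B > 0" "\<And>s. s \<in> {?a..?a + \<eta>} \<Longrightarrow> cmod (P s (complex_of_real k)) \<le> B"
      unfolding bounded_pos by auto
    have "gap k k' r \<le> (4 * c + 4 * B) * \<bar>k' - k\<bar>"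
      if "\<bar>k' - k\<bar> \<le> 1" "0 \<le> r" "r \<le> real (Suc n) * \<eta>" for k' r
    proof (cases "r \<le> ?a")
      case True
      have "gap k k' r \<le> c * \<bar>k' - k\<bar>" using c(2) that True by simp
      also have "\<dots> \<le> (4 * c + 4 * B) * \<bar>k' - k\<bar>" using c(1) B(1) by (intro mult_right_mono) auto
      finally show ?thesis .
    next
      case False
      have "gap k k' r \<le> 4 * gap k k' ?a + 4 * B * \<bar>k' - k\<bar>"
        by (rule gap_step[where b = "?a + \<eta>"])
           (use a0 \<eta> B k\<eta> that False in \<open>auto simp: algebra_simps\<close>)
      also have "gap k k' ?a \<le> c * \<bar>k' - k\<bar>" using c(2)[OF that(1) a0] by simp
      finally show ?thesis by (simp add: algebra_simps)
    qed
    moreover have "0 \<le> 4 * c + 4 * B" using c(1) B(1) by simp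
    ultimately show ?case by (intro exI[of _ "4 * c + 4 * B"]) blast
  qed
  note step = this
  obtain n where "R / \<eta> < real n" using reals_Archimedean2 by blast
  then have "R \<le> real n * \<eta>" using \<eta> by (simp add: field_simps)
  then show ?thesis using step[of n] by (meson order_trans)
qed

text \<open>The constant may vary with \<open>k\<close>, since only continuity at each point is
  drawn from it. Borel measurability then passes to \<open>\<sigma>\<close>, whose sets are the
  Borel sets.\<close>

lemma measurable_if_locally_Lipschitz:
  fixes F :: "real \<Rightarrow> complex"
  assumes "\<And>k k'. \<bar>k' - k\<bar> \<le> 1 \<Longrightarrow> cmod (F k' - F k) \<le> c k * \<bar>k' - k\<bar>"
  shows "F \<in> borel_measurable \<sigma>"
proof -
  have "isCont F k" for k
  proof -
    have "((\<lambda>k'. F k' - F k) \<longlongrightarrow> 0) (at k)"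
    proof (rule Lim_null_comparison)
      show "\<forall>\<^sub>F k' in at k. cmod (F k' - F k) \<le> c k * \<bar>k' - k\<bar>"
        using assms by (auto simp: eventually_at dist_real_def intro!: exI[of _ 1])
      show "((\<lambda>k'. c k * \<bar>k' - k\<bar>) \<longlongrightarrow> 0) (at k)"
        by (rule tendsto_eq_intros refl | simp)+
    qed
    then show ?thesis by (simp add: isCont_def LIM_zero_iff)
  qed
  then have "F \<in> borel_measurable borel"
    by (intro borel_measurable_continuous_onI continuous_at_imp_continuous_on) auto
  then show ?thesis by (simp only: measurable_cong_sets[OF sets_\<sigma> refl])
qed

lemma partial_measurable [measurable]:
  assumes f: "L2_loc_half_line f" and "0 \<le> a"
  shows "partial f a b \<in> borel_measurable \<sigma>"
proof -
  obtain c where c: "\<And>k. c k \<ge> 0"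
      "\<And>k k' r. \<bar>k' - k\<bar> \<le> 1 \<Longrightarrow> 0 \<le> r \<Longrightarrow> r \<le> b \<Longrightarrow> gap k k' r \<le> c k * \<bar>k' - k\<bar>"
    using gap_bound[of _ b] by metis
  show ?thesis
  proof (rule measurable_if_locally_Lipschitz)
    fix k k' :: real assume k: "\<bar>k' - k\<bar> \<le> 1"
    let ?d = "\<lambda>s. P s (complex_of_real k') - P s (complex_of_real k)"
    have "partial f a b k' - partial f a b k = integral {a..b} (\<lambda>s. f s * ?d s)"
      unfolding partial_def right_diff_distrib
      by (intro integral_diff[symmetric] set_lebesgue_integral_eq_integral(1) mult_P_abs assms)
    also have "cmod \<dots> \<le> (c k * \<bar>k' - k\<bar>) * integral {a..b} (\<lambda>s. cmod (f s))"
    proof (intro norm_integral_mult_le L2_loc_half_line_abs continuous_intros cont assms)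
      fix s assume "s \<in> {a..b}"
      then show "cmod (?d s) \<le> c k * \<bar>k' - k\<bar>"
        using c(2)[OF k, of s] \<open>0 \<le> a\<close> by (auto intro: order_trans[OF le_gap(1)])
    qed
    finally show "cmod (partial f a b k' - partial f a b k)
        \<le> (c k * integral {a..b} (\<lambda>s. cmod (f s))) * \<bar>k' - k\<bar>" by (simp add: mult_ac)
  qed
qed

lemma P_measurable [measurable]:
  assumes "0 \<le> r"
  shows "(\<lambda>k. P r (complex_of_real k)) \<in> borel_measurable \<sigma>"
proof -
  obtain c where c: "\<And>k. c k \<ge> 0"
      "\<And>k k' s. \<bar>k' - k\<bar> \<le> 1 \<Longrightarrow> 0 \<le> s \<Longrightarrow> s \<le> r \<Longrightarrow> gap k k' s \<le> c k * \<bar>k' - k\<bar>"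
    using gap_bound[of _ r] by metis
  show ?thesis
  proof (rule measurable_if_locally_Lipschitz)
    fix k k' :: real assume k: "\<bar>k' - k\<bar> \<le> 1"
    show "cmod (P r (complex_of_real k') - P r (complex_of_real k)) \<le> c k * \<bar>k' - k\<bar>"
      using c(2)[OF k assms] by (auto intro: order_trans[OF le_gap(1)])
  qed
qed

end

section \<open>The bound on K\<close>

context krein
begin

text \<open>The ramp \<open>r + \<delta> - s\<close> vanishes at \<open>r + \<delta>\<close>, so the
  only boundary value that survives is the one at \<open>r\<close>; its slope \<open>-1\<close>
  produces the plain integral of \<open>P\<close>.\<close>

lemma ramp_identity:
  assumes "0 \<le> r"
  shows "\<i> * k * integral {r..r+\<delta>} (\<lambda>s. complex_of_real (r + \<delta> - s) * P s k) -
      integral {r..r+\<delta>} (\<lambda>s. cnj (A s) * (complex_of_real (r + \<delta> - s) * Pstar s k)) -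
      integral {r..r+\<delta>} (\<lambda>s. P s k) = - (complex_of_real \<delta> * P r k)"
proof -
  let ?l = "\<lambda>s. complex_of_real (r + \<delta> - s)"
  have le: "r \<le> r + \<delta>" using \<delta>_pos by simp
  have "((\<lambda>s. ?l s * (\<i> * k * P s k - cnj (A s) * Pstar s k) + (-1) * P s k) has_integral
      (?l (r + \<delta>) * P (r + \<delta>) k - ?l r * P r k)) {r..r+\<delta>}"
  proof (rule abs_cont_on_has_integral[OF _ le])
    show "abs_cont_on r (r + \<delta>) (\<lambda>s. ?l s * P s k)"
    proof (intro abs_cont_on_mult abs_cont assms lipschitz_imp_abs_cont_on)
      fix x y
      have "?l x - ?l y = complex_of_real (y - x)" by simp
      then show "cmod (?l x - ?l y) \<le> 1 * \<bar>x - y\<bar>" by (simp only: norm_of_real mult_1 abs_minus_commute)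
    qed
    have l: "(?l has_vector_derivative -1) (at x)" for x
    proof -
      have "((\<lambda>s. r + \<delta> - s) has_real_derivative -1) (at x)"
        by (auto intro!: derivative_eq_intros)
      from has_vector_derivative_of_real[OF this] show ?thesis by simp
    qed
    show "AE x in lebesgue. r < x \<and> x < r + \<delta> \<longrightarrow>
        ((\<lambda>s. ?l s * P s k) has_vector_derivative
          (?l x * (\<i> * k * P x k - cnj (A x) * Pstar x k) + (-1) * P x k)) (at x)"
      using derivative[of k]
    proof (rule eventually_mono, intro impI)
      fix x
      assume "0 < x \<longrightarrow>
         ((\<lambda>s. P s k) has_vector_derivative (\<i> * k * P x k - cnj (A x) * Pstar x k)) (at x) \<and>
         ((\<lambda>s. Pstar s k) has_vector_derivative (- A x * P x k)) (at x)"
        and "r < x \<and> x < r + \<delta>"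
      then have "((\<lambda>s. P s k) has_vector_derivative (\<i> * k * P x k - cnj (A x) * Pstar x k)) (at x)"
        using assms by simp
      from has_vector_derivative_mult[OF l this]
      show "((\<lambda>s. ?l s * P s k) has_vector_derivative
          (?l x * (\<i> * k * P x k - cnj (A x) * Pstar x k) + (-1) * P x k)) (at x)" .
    qed
  qed
  moreover have "(\<lambda>s. ?l s * (\<i> * k * P s k - cnj (A s) * Pstar s k) + (-1) * P s k)
     = (\<lambda>s. \<i> * k * (?l s * P s k) - cnj (A s) * (?l s * Pstar s k) - P s k)"
    by (rule ext) algebra
  ultimately have h: "((\<lambda>s. \<i> * k * (?l s * P s k) - cnj (A s) * (?l s * Pstar s k) - P s k) has_integral
      - (complex_of_real \<delta> * P r k)) {r..r+\<delta>}" by simp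
  have "((\<lambda>s. \<i> * k * (?l s * P s k) - cnj (A s) * (?l s * Pstar s k) - P s k) has_integral
      (\<i> * k * integral {r..r+\<delta>} (\<lambda>s. ?l s * P s k) -
      integral {r..r+\<delta>} (\<lambda>s. cnj (A s) * (?l s * Pstar s k)) -
      integral {r..r+\<delta>} (\<lambda>s. P s k))) {r..r+\<delta>}"
    by (intro has_integral_diff has_integral_mult_right integrable_integral
        integrable_continuous_real set_lebesgue_integral_eq_integral(1)
        absolutely_integrable_mult_continuous cnj_A_abs continuous_intros cont assms)
  from has_integral_unique[OF this h] show ?thesis .
qed

text \<open>The integral with \<open>Pstar\<close> is at most
  \<open>\<delta> * (2 * ?p) * (1/4)\<close>, half of the left side \<open>\<delta> * ?p\<close>,
  and can be absorbed. What remains are two transforms that the isometry covers.\<close>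

lemma cmod_P_square_le:
  assumes "0 \<le> r"
  shows "(cmod (P r (complex_of_real k)))\<^sup>2 / (1 + k\<^sup>2) \<le> 4 / \<delta>\<^sup>2 *
    ((cmod (partial (\<lambda>_. 1) r (r + \<delta>) k))\<^sup>2 +
     (cmod (partial (\<lambda>s. complex_of_real (r + \<delta> - s)) r (r + \<delta>) k))\<^sup>2)"
proof -
  let ?k = "complex_of_real k" and ?l = "\<lambda>s. complex_of_real (r + \<delta> - s)"
  let ?p = "cmod (P r ?k)"
  define T1 where "T1 = cmod (partial (\<lambda>_. 1) r (r + \<delta>) k)"
  define T2 where "T2 = cmod (partial ?l r (r + \<delta>) k)"
  let ?J = "integral {r..r+\<delta>} (\<lambda>s. cnj (A s) * (?l s * Pstar s ?k))"
  have le: "r \<le> r + \<delta>" using \<delta>_pos by simp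
  have "cmod ?J \<le> (\<delta> * (2 * ?p)) * integral {r..r+\<delta>} (\<lambda>s. cmod (cnj (A s)))"
  proof (intro norm_integral_mult_le cnj_A_abs continuous_intros cont assms)
    fix s assume s: "s \<in> {r..r+\<delta>}"
    have "cmod (Pstar s ?k) \<le> 2 * ?p"
      using s assms cmod_P_le[of r s k] by (simp add: cmod_Pstar)
    moreover have "cmod (?l s) \<le> \<delta>" using s unfolding norm_of_real by auto
    ultimately show "cmod (?l s * Pstar s ?k) \<le> \<delta> * (2 * ?p)"
      unfolding norm_mult using \<delta>_pos by (intro mult_mono) auto
  qed
  also have "\<dots> \<le> (\<delta> * (2 * ?p)) * (1/4)"
    using integral_A_le[OF assms le] \<delta>_pos by (intro mult_left_mono) auto
  finally have J: "cmod ?J \<le> \<delta> * ?p / 2" by simp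
  have tri: "cmod (u - v + w) \<le> cmod u + cmod v + cmod w" for u v w
    by (rule order_trans[OF norm_triangle_ineq]) (simp add: norm_triangle_ineq4)
  have eq: "complex_of_real \<delta> * P r ?k = partial (\<lambda>_. 1) r (r + \<delta>) k - \<i> * ?k * partial ?l r (r + \<delta>) k + ?J"
    using ramp_identity[OF assms, of ?k] unfolding partial_def mult_1 by algebra
  have "cmod (complex_of_real \<delta> * P r ?k) \<le> T1 + cmod (\<i> * ?k * partial ?l r (r + \<delta>) k) + cmod ?J"
    unfolding T1_def eq by (rule tri)
  then have "\<delta> * ?p \<le> T1 + \<bar>k\<bar> * T2 + \<delta> * ?p / 2"
    using J \<delta>_pos unfolding norm_mult norm_of_real norm_ii T2_def by simp
  then have "\<delta> * ?p \<le> 2 * (T1 + \<bar>k\<bar> * T2)" by simp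
  then have "(\<delta> * ?p)\<^sup>2 \<le> (2 * (T1 + \<bar>k\<bar> * T2))\<^sup>2"
    using \<delta>_pos by (intro power_mono) auto
  also have "\<dots> = 4 * (T1 + \<bar>k\<bar> * T2)\<^sup>2" by (simp add: power2_eq_square algebra_simps)
  \<comment> \<open>Cauchy-Schwarz for the vectors \<open>(1, \<bar>k\<bar>)\<close> and
    \<open>(T1, T2)\<close>; the weight of the theorem arises here.\<close>
  also have "(T1 + \<bar>k\<bar> * T2)\<^sup>2 \<le> (1 + k\<^sup>2) * (T1\<^sup>2 + T2\<^sup>2)"
  proof -
    have "0 \<le> (\<bar>k\<bar> * T1 - T2)\<^sup>2" by simp
    then have "0 \<le> k\<^sup>2 * T1\<^sup>2 - 2 * \<bar>k\<bar> * T1 * T2 + T2\<^sup>2"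
      by (simp add: power2_diff power_mult_distrib)
    then show ?thesis by (simp add: power2_sum power_mult_distrib algebra_simps)
  qed
  finally have main: "\<delta>\<^sup>2 * ?p\<^sup>2 \<le> 4 * ((1 + k\<^sup>2) * (T1\<^sup>2 + T2\<^sup>2))"
    by (simp add: power_mult_distrib)
  have k: "1 + k\<^sup>2 > 0" by (simp add: add_pos_nonneg)
  have "?p\<^sup>2 / (1 + k\<^sup>2) = \<delta>\<^sup>2 * ?p\<^sup>2 / (\<delta>\<^sup>2 * (1 + k\<^sup>2))"
    using \<delta>_pos by simp
  also have "\<dots> \<le> 4 * ((1 + k\<^sup>2) * (T1\<^sup>2 + T2\<^sup>2)) / (\<delta>\<^sup>2 * (1 + k\<^sup>2))"
    using \<delta>_pos k by (intro divide_right_mono main) auto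
  also have "\<dots> = 4 / \<delta>\<^sup>2 * (T1\<^sup>2 + T2\<^sup>2)" using \<delta>_pos k by simp
  finally show ?thesis unfolding T1_def T2_def .
qed

text \<open>By the isometry each of the two transforms has squared norm at most
  \<open>\<delta>\<close>, so the bound is \<open>4 / \<delta>^2 * (2 * \<delta>) = 8 * m\<close>;
  then \<open>136 = 8 * 17\<close> with the 17 of \<open>m_bounds\<close>.\<close>

theorem nn_integral_P_le:
  assumes "0 \<le> r"
  shows "(\<integral>\<^sup>+k. ennreal ((cmod (P r (complex_of_real k)))\<^sup>2 / (1 + k\<^sup>2)) \<partial>\<sigma>)
    \<le> ennreal (136 * (1 + (stummel_norm A)\<^sup>2))"
proof -
  let ?l = "\<lambda>s. complex_of_real (r + \<delta> - s)"
  have L: "L2_loc_half_line (\<lambda>_. 1)" "L2_loc_half_line ?l"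
    by (intro continuous_imp_L2_loc_half_line continuous_intros)+
  have le: "r \<le> r + \<delta>" using \<delta>_pos by simp
  have e: "ennreal (c * (x + y)) = ennreal c * (ennreal x + ennreal y)" if "0 \<le> c" "0 \<le> x" "0 \<le> y" for c x y
    using that by (simp add: ennreal_mult')
  have [measurable]: "partial (\<lambda>_. 1) r (r + \<delta>) \<in> borel_measurable \<sigma>"
      "partial ?l r (r + \<delta>) \<in> borel_measurable \<sigma>"
    by (rule partial_measurable[OF L(1) assms], rule partial_measurable[OF L(2) assms])
  have m1: "(\<lambda>k. ennreal ((cmod (partial (\<lambda>_. 1) r (r + \<delta>) k))\<^sup>2)) \<in> borel_measurable \<sigma>"
    and m2: "(\<lambda>k. ennreal ((cmod (partial ?l r (r + \<delta>) k))\<^sup>2)) \<in> borel_measurable \<sigma>"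
    by measurable
  \<comment> \<open>Since \<open>\<delta> \<le> 1\<close>, the ramp is bounded by 1 and its energy
    by the length of the interval.\<close>
  have "integral {r..r+\<delta>} (\<lambda>s. (cmod (?l s))\<^sup>2) \<le> integral {r..r+\<delta>} (\<lambda>s. 1)"
  proof (rule integral_le)
    show "(\<lambda>s. (cmod (?l s))\<^sup>2) integrable_on {r..r+\<delta>}"
      by (intro integrable_continuous_real continuous_intros)
    fix s assume "s \<in> {r..r+\<delta>}"
    then have "\<bar>r + \<delta> - s\<bar> \<le> 1" using \<delta>_le_1 by auto
    then have "\<bar>r + \<delta> - s\<bar>\<^sup>2 \<le> 1" by (intro power_le_one) auto
    then show "(cmod (?l s))\<^sup>2 \<le> 1" unfolding norm_of_real .
  qed (rule integrable_const_ivl)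
  then have l2: "integral {r..r+\<delta>} (\<lambda>s. (cmod (?l s))\<^sup>2) \<le> \<delta>" using \<delta>_pos by simp
  have "(\<integral>\<^sup>+k. ennreal ((cmod (P r (complex_of_real k)))\<^sup>2 / (1 + k\<^sup>2)) \<partial>\<sigma>)
    \<le> (\<integral>\<^sup>+k. ennreal (4 / \<delta>\<^sup>2) * (ennreal ((cmod (partial (\<lambda>_. 1) r (r + \<delta>) k))\<^sup>2) +
        ennreal ((cmod (partial ?l r (r + \<delta>) k))\<^sup>2)) \<partial>\<sigma>)"
  proof (rule nn_integral_mono)
    fix k
    show "ennreal ((cmod (P r (complex_of_real k)))\<^sup>2 / (1 + k\<^sup>2)) \<le>
       ennreal (4 / \<delta>\<^sup>2) * (ennreal ((cmod (partial (\<lambda>_. 1) r (r + \<delta>) k))\<^sup>2) +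
        ennreal ((cmod (partial ?l r (r + \<delta>) k))\<^sup>2))"
      by (rule order_trans[OF ennreal_leI[OF cmod_P_square_le[OF assms]]], subst e) simp_all
  qed
  also have "\<dots> \<le> ennreal (4 / \<delta>\<^sup>2 * (\<delta> + \<delta>))"
  proof (intro nn_integral_cmult_le nn_integral_add_le borel_measurable_add m1 m2)
    show "(\<integral>\<^sup>+k. ennreal ((cmod (partial (\<lambda>_. 1) r (r + \<delta>) k))\<^sup>2) \<partial>\<sigma>) \<le> ennreal \<delta>"
      unfolding isometry[OF L(1) assms le] using \<delta>_pos by simp
    show "(\<integral>\<^sup>+k. ennreal ((cmod (partial ?l r (r + \<delta>) k))\<^sup>2) \<partial>\<sigma>) \<le> ennreal \<delta>"
      unfolding isometry[OF L(2) assms le] by (rule ennreal_leI[OF l2])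
  qed (use \<delta>_pos in auto)
  also have "\<dots> \<le> ennreal (136 * (1 + (stummel_norm A)\<^sup>2))"
  proof (rule ennreal_leI)
    have "4 / \<delta>\<^sup>2 * (\<delta> + \<delta>) = 8 * real m" using m_ge by (simp add: \<delta>_def power2_eq_square)
    then show "4 / \<delta>\<^sup>2 * (\<delta> + \<delta>) \<le> 136 * (1 + (stummel_norm A)\<^sup>2)" using m_bounds(2) by simp
  qed
  finally show ?thesis .
qed

lemma krein_K_le: "krein_K P \<sigma> \<le> ennreal (136 * (1 + (stummel_norm A)\<^sup>2))"
  unfolding krein_K_def kappa_def by (rule SUP_least, rule nn_integral_P_le) simp

lemma le_krein_K:
  "0 \<le> r \<Longrightarrow> (\<integral>\<^sup>+k. ennreal ((cmod (P r (complex_of_real k)))\<^sup>2 / kappa k) \<partial>\<sigma>) \<le> krein_K P \<sigma>"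
  unfolding krein_K_def by (rule SUP_upper) simp

end

section \<open>The maximal inequality\<close>

text \<open>The quadratic \<open>X - 2 * t * Z + t^2 * Y\<close> is nonnegative for every
  \<open>t\<close>, in particular at its minimum \<open>t = Z / Y\<close>.\<close>

lemma cauchy_schwarz_integral:
  fixes f g :: "real \<Rightarrow> complex"
  assumes f: "f absolutely_integrable_on {a..b}" "(\<lambda>x. (cmod (f x))\<^sup>2) integrable_on {a..b}"
    and g: "continuous_on {a..b} g"
  shows "(cmod (integral {a..b} (\<lambda>x. f x * g x)))\<^sup>2 \<le>
    integral {a..b} (\<lambda>x. (cmod (f x))\<^sup>2) * integral {a..b} (\<lambda>x. (cmod (g x))\<^sup>2)"
proof -
  define X where "X = integral {a..b} (\<lambda>x. (cmod (f x))\<^sup>2)"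
  define Y where "Y = integral {a..b} (\<lambda>x. (cmod (g x))\<^sup>2)"
  define Z where "Z = integral {a..b} (\<lambda>x. cmod (f x * g x))"
  have fg: "(\<lambda>x. f x * g x) integrable_on {a..b}" "(\<lambda>x. cmod (f x * g x)) integrable_on {a..b}"
    using absolutely_integrable_mult_continuous[OF f(1) g] by (auto simp: absolutely_integrable_on_def)
  have gg: "(\<lambda>x. (cmod (g x))\<^sup>2) integrable_on {a..b}"
    by (intro integrable_continuous_real continuous_intros g)
  have q: "0 \<le> X - 2 * t * Z + t\<^sup>2 * Y" for t
  proof -
    have "((\<lambda>x. (cmod (f x))\<^sup>2 - 2 * t * cmod (f x * g x) + t\<^sup>2 * (cmod (g x))\<^sup>2) has_integral
        X - 2 * t * Z + t\<^sup>2 * Y) {a..b}"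
      unfolding X_def Y_def Z_def
      by (intro has_integral_add has_integral_diff has_integral_mult_right integrable_integral f fg gg)
    then show ?thesis
    proof (rule has_integral_nonneg)
      fix x
      have "(cmod (f x))\<^sup>2 - 2 * t * cmod (f x * g x) + t\<^sup>2 * (cmod (g x))\<^sup>2 = (cmod (f x) - t * cmod (g x))\<^sup>2"
        by (simp add: norm_mult power2_eq_square algebra_simps)
      then show "0 \<le> (cmod (f x))\<^sup>2 - 2 * t * cmod (f x * g x) + t\<^sup>2 * (cmod (g x))\<^sup>2" by simp
    qed
  qed
  have Z: "Z \<ge> 0" unfolding Z_def by (rule Henstock_Kurzweil_Integration.integral_nonneg[OF fg(2)]) simp
  have Y: "Y \<ge> 0" unfolding Y_def by (rule Henstock_Kurzweil_Integration.integral_nonneg[OF gg]) simp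
  have "Z\<^sup>2 \<le> X * Y"
  proof (cases "Y = 0")
    case True
    have "Z = 0"
    proof (rule ccontr)
      assume "Z \<noteq> 0"
      \<comment> \<open>For \<open>Y = 0\<close> the quadratic is affine in \<open>t\<close>; at
        this \<open>t\<close> it would equal \<open>-1\<close>.\<close>
      with q[of "(X + 1) / (2 * Z)"] True show False by simp
    qed
    with True show ?thesis by simp
  next
    case False
    then have "Y > 0" using Y by simp
    with q[of "Z / Y"] have "0 \<le> X - Z\<^sup>2 / Y"
      by (simp add: power2_eq_square field_simps)
    then show ?thesis using \<open>Y > 0\<close> by (simp add: field_simps)
  qed
  moreover have "cmod (integral {a..b} (\<lambda>x. f x * g x)) \<le> Z"
    unfolding Z_def by (rule integral_norm_bound_integral[OF fg]) simp
  then have "(cmod (integral {a..b} (\<lambda>x. f x * g x)))\<^sup>2 \<le> Z\<^sup>2" by (intro power_mono) auto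
  ultimately show ?thesis unfolding X_def Y_def by linarith
qed

section \<open>The logarithmic weight\<close>

definition with_log :: "(real \<Rightarrow> complex) \<Rightarrow> real \<Rightarrow> complex" where
  "with_log f r = f r * complex_of_real (ln (2 + r))"

lemma cmod_with_log: "(cmod (with_log f r))\<^sup>2 = (cmod (f r))\<^sup>2 * (ln (2 + r))\<^sup>2"
  by (simp add: with_log_def norm_mult power_mult_distrib)

lemma ln_ge_two_thirds: "0 \<le> r \<Longrightarrow> 2/3 \<le> ln (2 + r :: real)"
  using ln2_ge_two_thirds ln_mono[of 2 "2 + r"] by linarith

text \<open>The logarithm is at least \<open>ln 2 \<ge> 2/3\<close>, and \<open>9/4\<close> is the
  inverse square of \<open>2/3\<close>.\<close>

lemma square_le_with_log:
  assumes "0 \<le> r"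
  shows "(cmod (f r))\<^sup>2 \<le> 9/4 * (cmod (with_log f r))\<^sup>2"
proof -
  have "(2/3)\<^sup>2 \<le> (ln (2 + r))\<^sup>2" by (intro power_mono ln_ge_two_thirds assms) simp
  then have "(cmod (f r))\<^sup>2 * (2/3)\<^sup>2 \<le> (cmod (f r))\<^sup>2 * (ln (2 + r))\<^sup>2"
    by (intro mult_left_mono) auto
  then show ?thesis unfolding cmod_with_log by (simp add: power_divide)
qed

text \<open>Links the dyadic factor of \<open>rademacher_menshov\<close> to the logarithm:
  \<open>(j + 1) / 3 \<le> ln (2 + r)\<close>, because \<open>ln 2 \<ge> 2/3\<close> and
  \<open>j + 1 \<le> 2 * j\<close> for \<open>j \<ge> 1\<close>.\<close>

lemma dyadic_square_le_with_log:
  assumes "2 ^ j \<le> r"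
  shows "(real j + 1)\<^sup>2 * (cmod (f r))\<^sup>2 \<le> 9 * (cmod (with_log f r))\<^sup>2"
proof -
  have r0: "0 \<le> r" using assms by (meson order_trans zero_le_numeral zero_le_power)
  have "(real j + 1) / 3 \<le> ln (2 + r)"
  proof (cases j)
    case 0
    then show ?thesis using ln_ge_two_thirds[OF r0] by simp
  next
    case (Suc i)
    have "(real j + 1) / 3 \<le> real j * (2/3)" using Suc by simp
    also have "\<dots> \<le> real j * ln 2" using ln2_ge_two_thirds by (intro mult_left_mono) auto
    also have "\<dots> = ln (2 ^ j)" by (simp add: ln_realpow)
    also have "\<dots> \<le> ln (2 + r)" using assms by (intro ln_mono) auto
    finally show ?thesis .
  qed
  then have "((real j + 1) / 3)\<^sup>2 \<le> (ln (2 + r))\<^sup>2" by (intro power_mono) auto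
  then have "((real j + 1) / 3)\<^sup>2 * (cmod (f r))\<^sup>2 \<le> (ln (2 + r))\<^sup>2 * (cmod (f r))\<^sup>2"
    by (intro mult_right_mono) auto
  then show ?thesis by (simp add: cmod_with_log power_divide mult.commute)
qed

text \<open>The logarithm is bounded away from zero on the half-line, so dividing by it preserves
  measurability and square integrability.\<close>

lemma L2_half_line_with_log:
  assumes "L2_half_line (with_log f)"
  shows "L2_half_line f"
proof -
  let ?M = "lebesgue_on {0..} :: real measure"
  have [measurable]: "with_log f \<in> borel_measurable ?M"
    and int: "integrable ?M (\<lambda>r. (cmod (with_log f r))\<^sup>2)"
    using assms by (auto simp: L2_half_line_def)
  have [measurable]: "(\<lambda>r. complex_of_real (ln (2 + r))) \<in> borel_measurable ?M"
    by (intro measurable_restrict_space1 measurable_completion) measurable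
  have "(\<lambda>r. with_log f r / complex_of_real (ln (2 + r))) \<in> borel_measurable ?M" by measurable
  also have "?this \<longleftrightarrow> f \<in> borel_measurable ?M"
  proof (rule measurable_cong)
    fix r assume "r \<in> space ?M"
    then have "ln (2 + r) \<noteq> 0" using ln_ge_two_thirds[of r] by (auto simp: space_restrict_space)
    then show "with_log f r / complex_of_real (ln (2 + r)) = f r" by (simp add: with_log_def)
  qed
  finally have [measurable]: "f \<in> borel_measurable ?M" .
  have "integrable ?M (\<lambda>r. (cmod (f r))\<^sup>2)"
  proof (rule Bochner_Integration.integrable_bound)
    show "integrable ?M (\<lambda>r. 9/4 * (cmod (with_log f r))\<^sup>2)"
      using int by (rule Bochner_Integration.integrable_mult_right)
    show "AE r in ?M. norm ((cmod (f r))\<^sup>2) \<le> norm (9/4 * (cmod (with_log f r))\<^sup>2)"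
    proof (rule AE_I2)
      fix r assume "r \<in> space ?M"
      then have "0 \<le> r" by (simp add: space_restrict_space)
      from square_le_with_log[OF this, of f]
      show "norm ((cmod (f r))\<^sup>2) \<le> norm (9/4 * (cmod (with_log f r))\<^sup>2)" by simp
    qed
  qed measurable
  then show ?thesis by (simp add: L2_half_line_def)
qed

lemma L2_half_line_integrable:
  assumes "L2_half_line f"
  shows "(\<lambda>r. (cmod (f r))\<^sup>2) integrable_on {0..}"
  using assms unfolding L2_half_line_def by (intro integrable_on_lebesgue_on) auto

lemma L2_loc_integrable:
  "L2_loc_half_line f \<Longrightarrow> 0 \<le> a \<Longrightarrow> (\<lambda>r. (cmod (f r))\<^sup>2) integrable_on {a..b}"
  by (intro set_lebesgue_integral_eq_integral(1) L2_loc_half_line_square)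

lemma integral_square_mono:
  assumes "L2_loc_half_line f" "0 \<le> a" "a \<le> b" "c \<le> d" "b \<le> d" "c \<le> a" "0 \<le> c"
  shows "integral {a..b} (\<lambda>r. (cmod (f r))\<^sup>2) \<le> integral {c..d} (\<lambda>r. (cmod (f r))\<^sup>2)"
  using assms by (intro integral_subset_le L2_loc_integrable) auto

lemma integral_square_diff:
  assumes "L2_loc_half_line f" "0 \<le> a" "a \<le> b"
  shows "integral {0..b} (\<lambda>r. (cmod (f r))\<^sup>2) - integral {0..a} (\<lambda>r. (cmod (f r))\<^sup>2)
    = integral {a..b} (\<lambda>r. (cmod (f r))\<^sup>2)"
  using Henstock_Kurzweil_Integration.integral_combine[OF assms(2,3) L2_loc_integrable[OF assms(1)]]
  by simp

section \<open>Partial integrals inside unit blocks and along the integers\<close>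

context krein
begin

text \<open>Values at grid points stand in for the integral: a finite sum can be integrated over
  \<open>\<sigma>\<close> term by term, without exchanging the integrals in \<open>r\<close> and
  \<open>k\<close>. The factor 4 is the square of the 2 in \<open>cmod_P_le\<close>.\<close>

lemma integral_P_square_le:
  assumes "0 \<le> a"
  shows "integral {a..a + real n * \<delta>} (\<lambda>s. (cmod (P s (complex_of_real k)))\<^sup>2) \<le>
    (\<Sum>j<n. 4 * \<delta> * (cmod (P (a + real j * \<delta>) (complex_of_real k)))\<^sup>2)"
proof (induction n)
  case (Suc n)
  let ?p = "\<lambda>s. (cmod (P s (complex_of_real k)))\<^sup>2"
  let ?b = "a + real n * \<delta>" and ?c = "a + real (Suc n) * \<delta>"
  have bc: "a \<le> ?b" "?b \<le> ?c" "?c - ?b = \<delta>" "0 \<le> ?b"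
    using assms \<delta>_pos by (auto simp: algebra_simps)
  have i: "?p integrable_on {x..y}" if "0 \<le> x" for x y
    by (intro integrable_continuous_real continuous_intros cont that)
  have "integral {?b..?c} ?p \<le> integral {?b..?c} (\<lambda>_. 4 * ?p ?b)"
  proof (rule integral_le[OF i[OF bc(4)] integrable_const_ivl])
    fix s assume s: "s \<in> {?b..?c}"
    have "cmod (P s (complex_of_real k)) \<le> 2 * cmod (P ?b (complex_of_real k))"
      using s bc by (intro cmod_P_le) auto
    then have "?p s \<le> (2 * cmod (P ?b (complex_of_real k)))\<^sup>2" by (intro power_mono) auto
    then show "?p s \<le> 4 * ?p ?b" by (simp add: power_mult_distrib)
  qed
  also have "\<dots> = 4 * \<delta> * ?p ?b" using bc by simp
  finally have "integral {?b..?c} ?p \<le> 4 * \<delta> * ?p ?b" .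
  moreover have "integral {a..?c} ?p = integral {a..?b} ?p + integral {?b..?c} ?p"
    by (rule Henstock_Kurzweil_Integration.integral_combine[OF bc(1,2) i[OF assms], symmetric])
  ultimately show ?case using Suc.IH by simp
qed simp

text \<open>The right side is free of \<open>t\<close>, so it controls the supremum over the whole
  block.\<close>

lemma partial_block_le:
  assumes f: "L2_loc_half_line f" and a: "0 \<le> a" "a \<le> t" "t \<le> a + 1"
  shows "(cmod (partial f a t k))\<^sup>2 \<le> integral {a..a+1} (\<lambda>r. (cmod (f r))\<^sup>2) *
    (\<Sum>j<m. 4 * \<delta> * (cmod (P (a + real j * \<delta>) (complex_of_real k)))\<^sup>2)"
proof -
  let ?p = "\<lambda>s. (cmod (P s (complex_of_real k)))\<^sup>2"
  have i: "?p integrable_on {x..y}" if "0 \<le> x" for x y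
    by (intro integrable_continuous_real continuous_intros cont that)
  have "(cmod (partial f a t k))\<^sup>2 \<le> integral {a..t} (\<lambda>r. (cmod (f r))\<^sup>2) * integral {a..t} ?p"
    unfolding partial_def
    by (rule cauchy_schwarz_integral[OF L2_loc_half_line_abs[OF f a(1)] L2_loc_integrable[OF f a(1)] cont(1)[OF a(1)]])
  also have "\<dots> \<le> integral {a..a+1} (\<lambda>r. (cmod (f r))\<^sup>2) * (\<Sum>j<m. 4 * \<delta> * ?p (a + real j * \<delta>))"
  proof (rule mult_mono)
    show "integral {a..t} (\<lambda>r. (cmod (f r))\<^sup>2) \<le> integral {a..a+1} (\<lambda>r. (cmod (f r))\<^sup>2)"
      using a by (intro integral_square_mono f) auto
    have "integral {a..t} ?p \<le> integral {a..a+1} ?p"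
      using a by (intro integral_subset_le i) auto
    also have "\<dots> \<le> (\<Sum>j<m. 4 * \<delta> * ?p (a + real j * \<delta>))"
      using integral_P_square_le[OF a(1), of m k] unfolding m_\<delta> .
    finally show "integral {a..t} ?p \<le> (\<Sum>j<m. 4 * \<delta> * ?p (a + real j * \<delta>))" .
    show "0 \<le> integral {a..a+1} (\<lambda>r. (cmod (f r))\<^sup>2)"
      by (intro Henstock_Kurzweil_Integration.integral_nonneg L2_loc_integrable f a) simp
    show "0 \<le> integral {a..t} ?p"
      by (intro Henstock_Kurzweil_Integration.integral_nonneg i a) simp
  qed
  finally show ?thesis .
qed

text \<open>Along the integers the isometry alone drives the estimate, hence no weight in
  \<open>k\<close>. The total energy contributes \<open>3 * 9/4\<close> and the dyadic energies
  \<open>6 * 9\<close>; the sum 60.75 is rounded up to 61.\<close>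

lemma nn_integral_SUP_partial:
  assumes f: "L2_half_line (with_log f)"
  shows "(\<integral>\<^sup>+k. (SUP n. ennreal ((cmod (partial f 0 (real n) k))\<^sup>2)) \<partial>\<sigma>)
    \<le> ennreal (61 * integral {0..} (\<lambda>r. (cmod (with_log f r))\<^sup>2))"
proof -
  define W where "W = integral {0..} (\<lambda>r. (cmod (with_log f r))\<^sup>2)"
  define w where "w t = integral {0..t} (\<lambda>r. (cmod (with_log f r))\<^sup>2)" for t
  define v where "v t = integral {0..t} (\<lambda>r. (cmod (f r))\<^sup>2)" for t
  have fl: "L2_loc_half_line (with_log f)" "L2_loc_half_line f"
    using f by (auto intro: L2_half_line_imp_loc L2_half_line_with_log)
  have w_le: "w t \<le> W" for t
    unfolding w_def W_def
    by (intro integral_subset_le L2_loc_integrable L2_half_line_integrable fl f) auto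
  have w_nonneg: "0 \<le> w t" for t
    unfolding w_def by (intro Henstock_Kurzweil_Integration.integral_nonneg L2_loc_integrable fl) auto
  have v_le: "v t \<le> 9/4 * w t" for t
    unfolding v_def w_def integral_mult_right[symmetric]
    by (intro integral_le integrable_on_mult_right L2_loc_integrable fl square_le_with_log) auto
  have dyadic: "(real j + 1)\<^sup>2 * (v (2 ^ Suc j) - v (2 ^ j)) \<le> 9 * (w (2 ^ Suc j) - w (2 ^ j))" for j
    unfolding v_def w_def
      integral_square_diff[OF fl(1) zero_le_power[OF zero_le_numeral] power_increasing[OF le_SucI[OF order_refl] one_le_numeral]]
      integral_square_diff[OF fl(2) zero_le_power[OF zero_le_numeral] power_increasing[OF le_SucI[OF order_refl] one_le_numeral]]
      integral_mult_right[symmetric]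
    by (intro integral_le integrable_on_mult_right L2_loc_integrable fl dyadic_square_le_with_log) auto
  interpret increment_bound \<sigma> "\<lambda>n. partial f 0 (real n)" "\<lambda>n. v (real n)"
  proof
    show "partial f 0 (real n) \<in> borel_measurable \<sigma>" for n
      by (rule partial_measurable[OF fl(2)]) simp
    fix i j :: nat assume "i \<le> j"
    then have ij: "0 \<le> real i" "real i \<le> real j" by auto
    have "partial f 0 (real j) k - partial f 0 (real i) k = partial f (real i) (real j) k" for k
      using partial_combine[OF fl(2) order_refl ij] by simp
    then show "(\<integral>\<^sup>+k. ennreal ((cmod (partial f 0 (real j) k - partial f 0 (real i) k))\<^sup>2) \<partial>\<sigma>)
        \<le> ennreal (v (real j) - v (real i))"
      unfolding v_def integral_square_diff[OF fl(2) ij] by (simp add: isometry[OF fl(2) ij])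
    show "v (real i) \<le> v (real j)"
      unfolding v_def using ij by (intro integral_square_mono fl) auto
  qed
  let ?g = "\<lambda>M k. SUP n\<in>{..(2::nat)^M}. ennreal ((cmod (partial f 0 (real n) k))\<^sup>2)"
  have bound: "(\<integral>\<^sup>+k. ?g M k \<partial>\<sigma>) \<le> ennreal (61 * W)" for M
  proof -
    have "(\<integral>\<^sup>+k. ?g M k \<partial>\<sigma>) \<le> ennreal (3 * (v (real (2^M)) - v (real 0)) +
        6 * (\<Sum>j<M. (real j + 1)\<^sup>2 * (v (real (2 ^ Suc j)) - v (real (2 ^ j)))))"
      by (rule rademacher_menshov) (simp add: partial_def)
    also have "\<dots> \<le> ennreal (61 * W)"
    proof (rule ennreal_leI)
      have "(\<Sum>j<M. (real j + 1)\<^sup>2 * (v (real (2 ^ Suc j)) - v (real (2 ^ j))))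
          \<le> (\<Sum>j<M. 9 * (w (2 ^ Suc j) - w (2 ^ j)))"
        using dyadic by (intro sum_mono) simp
      \<comment> \<open>The log-weighted dyadic energies telescope, which makes the bound
        independent of \<open>M\<close>.\<close>
      also have "\<dots> = 9 * (w (2 ^ M) - w (2 ^ 0))"
        unfolding sum_distrib_left[symmetric] by (subst sum_lessThan_telescope[of "\<lambda>j. w (2 ^ j)"]) (rule refl)
      also have "\<dots> \<le> 9 * W" using w_le[of "2 ^ M"] w_nonneg[of "2 ^ 0"] by simp
      finally have "(\<Sum>j<M. (real j + 1)\<^sup>2 * (v (real (2 ^ Suc j)) - v (real (2 ^ j)))) \<le> 9 * W" .
      moreover have "v (real (2^M)) \<le> 9/4 * W" using v_le[of "real (2^M)"] w_le[of "real (2^M)"] by linarith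
      moreover have "v (real 0) = 0" by (simp add: v_def)
      moreover have "0 \<le> W" using w_nonneg w_le order_trans by blast
      moreover have "3 * (y - z) + 6 * x \<le> 61 * W"
        if "x \<le> 9 * W" "y \<le> 9/4 * W" "z = 0" "0 \<le> W" for x y z :: real
        using that by simp
      ultimately show "3 * (v (real (2^M)) - v (real 0)) +
        6 * (\<Sum>j<M. (real j + 1)\<^sup>2 * (v (real (2 ^ Suc j)) - v (real (2 ^ j)))) \<le> 61 * W"
        by blast
    qed
    finally show ?thesis .
  qed
  \<comment> \<open>The maxima over \<open>n \<le> 2^M\<close> increase with \<open>M\<close>, so
    monotone convergence passes the uniform bound on to the supremum over all
    \<open>n\<close>.\<close>
  have "(SUP n. ennreal ((cmod (partial f 0 (real n) k))\<^sup>2)) \<le> (SUP M. ?g M k)" for k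
  proof (rule SUP_least)
    fix n :: nat
    have "n \<in> {..2 ^ n}" by simp
    then have "ennreal ((cmod (partial f 0 (real n) k))\<^sup>2) \<le> ?g n k" by (rule SUP_upper)
    also have "\<dots> \<le> (SUP M. ?g M k)" by (rule SUP_upper) simp
    finally show "ennreal ((cmod (partial f 0 (real n) k))\<^sup>2) \<le> (SUP M. ?g M k)" .
  qed
  then have "(\<integral>\<^sup>+k. (SUP n. ennreal ((cmod (partial f 0 (real n) k))\<^sup>2)) \<partial>\<sigma>) \<le> (\<integral>\<^sup>+k. (SUP M. ?g M k) \<partial>\<sigma>)"
    by (intro nn_integral_mono)
  also have "\<dots> = (SUP M. (\<integral>\<^sup>+k. ?g M k \<partial>\<sigma>))"
  proof (rule nn_integral_monotone_convergence_SUP)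
    show "incseq ?g"
    proof (intro incseq_SucI le_funI SUP_subset_mono order_refl)
      fix M show "{..(2::nat) ^ M} \<subseteq> {..2 ^ Suc M}" by auto
    qed
    show "?g M \<in> borel_measurable \<sigma>" for M by measurable
  qed
  also have "\<dots> \<le> ennreal (61 * W)" by (rule SUP_least) (rule bound)
  finally show ?thesis unfolding W_def .
qed

end

text \<open>The estimate along the integers has a constant without \<open>K\<close>; this lower
  bound lets the \<open>Linf_norm\<close> term absorb it. On \<open>[0, 1]\<close>, which is not
  negligible, \<open>1 / kappa\<close> is at least \<open>1/2\<close>.\<close>

lemma Linf_norm_kappa_ge: "ennreal (1/2) \<le> Linf_norm (\<lambda>k. 1 / kappa k)"
proof (rule ccontr)
  let ?g = "\<lambda>x. ennreal \<bar>1 / kappa x\<bar>"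
  assume "\<not> ?thesis"
  then have less: "esssup lebesgue ?g < ennreal (1/2)" by (simp add: Linf_norm_def)
  have "AE x in lebesgue. ?g x \<le> esssup lebesgue ?g" by (rule esssup_AE)
  then have "AE x::real in lebesgue. x \<notin> {0..1}"
  proof (rule eventually_mono)
    fix x :: real assume g: "?g x \<le> esssup lebesgue ?g"
    show "x \<notin> {0..1}"
    proof
      assume x: "x \<in> {0..1}"
      have "x\<^sup>2 \<le> 1" using x by (intro power_le_one) auto
      then have "1/2 \<le> \<bar>1 / kappa x\<bar>" by (simp add: kappa_def field_simps add_pos_nonneg)
      then have "ennreal (1/2) \<le> ?g x" by (rule ennreal_leI)
      with g less show False by simp
    qed
  qed
  then obtain N where N: "negligible N" "{x::real. \<not> x \<notin> {0..1}} \<subseteq> N"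
    unfolding eventually_ae_filter_negligible by blast
  then have "cbox 0 1 \<subseteq> N" by auto
  with N(1) have "negligible (cbox 0 (1::real))" by (rule negligible_subset)
  then show False unfolding negligible_interval by simp
qed

section \<open>Tails of f and convergence for a growing upper limit\<close>

definition tail :: "(real \<Rightarrow> complex) \<Rightarrow> nat \<Rightarrow> real \<Rightarrow> complex" where
  "tail f N r = (if real N \<le> r then f r else 0)"

lemma L2_half_line_tail:
  assumes "L2_half_line f"
  shows "L2_half_line (tail f N)"
proof -
  let ?M = "lebesgue_on {0..} :: real measure"
  have [measurable]: "f \<in> borel_measurable ?M"
    and int: "integrable ?M (\<lambda>r. (cmod (f r))\<^sup>2)"
    using assms by (auto simp: L2_half_line_def)
  have [measurable]: "(\<lambda>r. r) \<in> borel_measurable ?M"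
    by (intro measurable_restrict_space1 measurable_completion) measurable
  have [measurable]: "tail f N \<in> borel_measurable ?M"
    unfolding tail_def[abs_def] by measurable
  have "integrable ?M (\<lambda>r. (cmod (tail f N r))\<^sup>2)"
    by (rule Bochner_Integration.integrable_bound[OF int]) (auto simp: tail_def)
  then show ?thesis by (simp add: L2_half_line_def)
qed

lemma with_log_tail: "with_log (tail f N) = tail (with_log f) N"
  by (auto simp: with_log_def tail_def)

lemma tail_integral_tendsto:
  assumes f: "L2_half_line f"
  shows "(\<lambda>N. integral {0..} (\<lambda>r. (cmod (tail f N r))\<^sup>2)) \<longlonglongrightarrow> 0"
proof -
  have "(\<lambda>N. integral {0..} (\<lambda>r. (cmod (tail f N r))\<^sup>2)) \<longlonglongrightarrow> integral {0::real..} (\<lambda>r. 0::real)"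
  proof (rule dominated_convergence(2))
    show "(\<lambda>r. (cmod (tail f N r))\<^sup>2) integrable_on {0..}" for N
      by (intro L2_half_line_integrable L2_half_line_tail f)
    show "(\<lambda>r. (cmod (f r))\<^sup>2) integrable_on {0..}" by (rule L2_half_line_integrable[OF f])
    show "norm ((cmod (tail f N r))\<^sup>2) \<le> (cmod (f r))\<^sup>2" for N r by (simp add: tail_def)
    show "(\<lambda>N. (cmod (tail f N r))\<^sup>2) \<longlonglongrightarrow> 0" for r
    proof (rule tendsto_eventually)
      obtain n where "r < real n" using reals_Archimedean2 by blast
      then show "\<forall>\<^sub>F N in sequentially. (cmod (tail f N r))\<^sup>2 = 0"
        by (auto simp: eventually_sequentially tail_def intro!: exI[of _ n])
    qed
  qed
  then show ?thesis by simp
qed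

text \<open>All real \<open>t\<close> are compared with one integer point, the form in which the
  majorant of a tail delivers the estimate. Naming the limit through the integer sequence makes it a
  measurable function of \<open>k\<close> later on.\<close>

lemma tendsto_at_top_if_cauchy:
  fixes F :: "real \<Rightarrow> complex"
  assumes "\<And>e. e > 0 \<Longrightarrow> \<exists>N::nat. \<forall>t\<ge>real N. cmod (F t - F (real N)) < e"
  shows "(F \<longlongrightarrow> lim (\<lambda>n. F (real n))) at_top"
proof -
  have "Cauchy (\<lambda>n. F (real n))"
    unfolding Cauchy_altdef2
  proof (intro allI impI)
    fix e :: real assume "e > 0"
    then obtain N where "\<forall>t\<ge>real N. cmod (F t - F (real N)) < e" using assms by blast
    then show "\<exists>N. \<forall>n\<ge>N. dist (F (real n)) (F (real N)) < e"
      by (intro exI[of _ N]) (simp add: dist_norm)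
  qed
  then have l: "(\<lambda>n. F (real n)) \<longlonglongrightarrow> lim (\<lambda>n. F (real n))" (is "_ \<longlonglongrightarrow> ?l")
    by (simp add: Cauchy_convergent_iff convergent_LIMSEQ_iff)
  show ?thesis
  proof (rule tendstoI)
    fix e :: real assume "e > 0"
    then have "e/2 > 0" by simp
    then obtain N where N: "\<And>t. t \<ge> real N \<Longrightarrow> cmod (F t - F (real N)) < e/2"
      using assms by blast
    have "cmod (?l - F (real N)) \<le> e/2"
    proof (rule LIMSEQ_le_const2[OF tendsto_norm[OF tendsto_diff[OF l tendsto_const]]])
      show "\<exists>M. \<forall>n\<ge>M. cmod (F (real n) - F (real N)) \<le> e/2"
        using N by (intro exI[of _ N]) (auto intro: less_imp_le)
    qed
    then have "dist (F t) ?l < e" if "t \<ge> real N" for t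
      using N[OF that] norm_triangle_ineq4[of "F t - F (real N)" "?l - F (real N)"]
      by (simp add: dist_norm)
    then show "\<forall>\<^sub>F t in at_top. dist (F t) ?l < e"
      unfolding eventually_at_top_linorder by blast
  qed
qed

context krein
begin

section \<open>A measurable majorant for the supremum over all upper limits\<close>

lemma kappa_measurable [measurable]: "kappa \<in> borel_measurable \<sigma>"
  unfolding measurable_cong_sets[OF sets_\<sigma> refl] kappa_def[abs_def] by measurable

lemma kappa_ge_1: "1 \<le> kappa k"
  by (simp add: kappa_def)

text \<open>The bound of \<open>partial_block_le\<close> divided by \<open>kappa\<close>; the
  division is done in every summand, where \<open>K\<close> bounds the integral over
  \<open>\<sigma>\<close>.\<close>

definition block :: "(real \<Rightarrow> complex) \<Rightarrow> nat \<Rightarrow> real \<Rightarrow> ennreal" where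
  "block f n k = ennreal (integral {real n..real n + 1} (\<lambda>r. (cmod (f r))\<^sup>2)) *
    (\<Sum>j<m. ennreal (4 * \<delta>) * ennreal ((cmod (P (real n + real j * \<delta>) (complex_of_real k)))\<^sup>2 / kappa k))"

text \<open>A sum over countably many blocks replaces the supremum over uncountably many upper
  limits, which keeps the function measurable. The part along the integers carries no weight because
  its bound is unweighted.\<close>

definition majorant :: "(real \<Rightarrow> complex) \<Rightarrow> real \<Rightarrow> ennreal" where
  "majorant f k = 2 * (SUP n. ennreal ((cmod (partial f 0 (real n) k))\<^sup>2)) + 2 * (\<Sum>n. block f n k)"

lemma weighted_P_measurable [measurable]:
  "(\<lambda>k. ennreal ((cmod (P (real n + real j * \<delta>) (complex_of_real k)))\<^sup>2 / kappa k)) \<in> borel_measurable \<sigma>"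
proof -
  have [measurable]: "(\<lambda>k. P (real n + real j * \<delta>) (complex_of_real k)) \<in> borel_measurable \<sigma>"
    using \<delta>_pos by (intro P_measurable) simp
  show ?thesis by measurable
qed

lemma block_measurable [measurable]: "block f n \<in> borel_measurable \<sigma>"
  unfolding block_def by measurable

lemma majorant_measurable:
  assumes "L2_loc_half_line f"
  shows "majorant f \<in> borel_measurable \<sigma>"
proof -
  have [measurable]: "partial f 0 (real n) \<in> borel_measurable \<sigma>" for n
    by (rule partial_measurable[OF assms]) simp
  show ?thesis unfolding majorant_def by measurable
qed

lemma partial_le_block:
  assumes f: "L2_loc_half_line f" and t: "real n \<le> t" "t \<le> real n + 1"
  shows "ennreal ((cmod (partial f (real n) t k))\<^sup>2 / kappa k) \<le> block f n k"
proof -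
  let ?E = "integral {real n..real n + 1} (\<lambda>r. (cmod (f r))\<^sup>2)"
  let ?p = "\<lambda>j. (cmod (P (real n + real j * \<delta>) (complex_of_real k)))\<^sup>2"
  have E: "0 \<le> ?E" by (intro Henstock_Kurzweil_Integration.integral_nonneg L2_loc_integrable f) auto
  have "(cmod (partial f (real n) t k))\<^sup>2 / kappa k \<le> ?E * (\<Sum>j<m. 4 * \<delta> * ?p j) / kappa k"
    using t kappa_ge_1[of k] by (intro divide_right_mono partial_block_le f) auto
  also have "\<dots> = ?E * (\<Sum>j<m. 4 * \<delta> * (?p j / kappa k))"
    by (simp only: times_divide_eq_right[symmetric] sum_divide_distrib)
  finally have "ennreal ((cmod (partial f (real n) t k))\<^sup>2 / kappa k) \<le> ennreal (?E * (\<Sum>j<m. 4 * \<delta> * (?p j / kappa k)))"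
    by (rule ennreal_leI)
  also have "\<dots> = ennreal ?E * ennreal (\<Sum>j<m. 4 * \<delta> * (?p j / kappa k))"
    by (rule ennreal_mult'[OF E])
  also have "ennreal (\<Sum>j<m. 4 * \<delta> * (?p j / kappa k)) = (\<Sum>j<m. ennreal (4 * \<delta> * (?p j / kappa k)))"
    using \<delta>_pos kappa_ge_1[of k] by (intro sum_ennreal[symmetric]) simp
  also have "\<dots> = (\<Sum>j<m. ennreal (4 * \<delta>) * ennreal (?p j / kappa k))"
    using \<delta>_pos by (intro sum.cong refl ennreal_mult') simp
  finally show ?thesis unfolding block_def .
qed

lemma partial_le_majorant:
  assumes f: "L2_loc_half_line f" and t: "0 \<le> t"
  shows "ennreal ((cmod (partial f 0 t k))\<^sup>2 / kappa k) \<le> majorant f k"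
proof -
  define n where "n = nat \<lfloor>t\<rfloor>"
  have n: "real n \<le> t" "t \<le> real n + 1" using t by (auto simp: n_def)
  have two: "ennreal (2 * x + 2 * y) = 2 * ennreal x + 2 * ennreal y" if "0 \<le> x" "0 \<le> y" for x y
    using that by (simp add: ennreal_mult')
  let ?a = "cmod (partial f 0 (real n) k)" and ?b = "cmod (partial f (real n) t k)"
  have "cmod (partial f 0 t k) \<le> ?a + ?b"
    using partial_combine[OF f order_refl _ n(1)] by (simp add: norm_triangle_ineq)
  then have "(cmod (partial f 0 t k))\<^sup>2 \<le> (?a + ?b)\<^sup>2" by (intro power_mono) auto
  also have "\<dots> \<le> (1 + 1/1) * ?a\<^sup>2 + (1 + 1) * ?b\<^sup>2" by (rule square_add_le) simp
  finally have "(cmod (partial f 0 t k))\<^sup>2 / kappa k \<le> (2 * ?a\<^sup>2 + 2 * ?b\<^sup>2) / kappa k"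
    using kappa_ge_1[of k] by (intro divide_right_mono) auto
  also have "\<dots> = 2 * (?a\<^sup>2 / kappa k) + 2 * (?b\<^sup>2 / kappa k)" by (simp add: add_divide_distrib)
  \<comment> \<open>As \<open>kappa k \<ge> 1\<close>, the weight may be dropped from the part along
    the integers.\<close>
  also have "\<dots> \<le> 2 * ?a\<^sup>2 + 2 * (?b\<^sup>2 / kappa k)"
    using kappa_ge_1[of k] mult_left_mono[of 1 "kappa k" "?a\<^sup>2"] by (simp add: divide_le_eq)
  finally have "ennreal ((cmod (partial f 0 t k))\<^sup>2 / kappa k) \<le> ennreal (2 * ?a\<^sup>2 + 2 * (?b\<^sup>2 / kappa k))"
    by (rule ennreal_leI)
  also have "\<dots> = 2 * ennreal (?a\<^sup>2) + 2 * ennreal (?b\<^sup>2 / kappa k)"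
    using kappa_ge_1[of k] by (intro two) auto
  also have "\<dots> \<le> majorant f k"
    unfolding majorant_def
  proof (intro add_mono mult_left_mono)
    show "ennreal (?a\<^sup>2) \<le> (SUP n. ennreal ((cmod (partial f 0 (real n) k))\<^sup>2))"
      by (rule SUP_upper) simp
    have "ennreal (?b\<^sup>2 / kappa k) \<le> block f n k" by (rule partial_le_block[OF f n])
    also have "\<dots> \<le> (\<Sum>n. block f n k)"
      using sum_le_suminf[of "\<lambda>n. block f n k" "{n}"] by (simp add: summableI)
    finally show "ennreal (?b\<^sup>2 / kappa k) \<le> (\<Sum>n. block f n k)" .
  qed auto
  finally show ?thesis .
qed

text \<open>The \<open>m\<close> summands have weight \<open>4 * \<delta>\<close> each, in total 4,
  so the step length drops out and \<open>A\<close> enters through \<open>K\<close> alone.\<close>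

lemma nn_integral_block:
  "(\<integral>\<^sup>+k. block f n k \<partial>\<sigma>) \<le> ennreal (integral {real n..real n + 1} (\<lambda>r. (cmod (f r))\<^sup>2)) * (4 * krein_K P \<sigma>)"
proof -
  let ?p = "\<lambda>j k. ennreal ((cmod (P (real n + real j * \<delta>) (complex_of_real k)))\<^sup>2 / kappa k)"
  have "(\<integral>\<^sup>+k. (\<Sum>j<m. ennreal (4 * \<delta>) * ?p j k) \<partial>\<sigma>) = (\<Sum>j<m. ennreal (4 * \<delta>) * (\<integral>\<^sup>+k. ?p j k \<partial>\<sigma>))"
    by (subst nn_integral_sum) (simp_all add: nn_integral_cmult)
  also have "\<dots> \<le> (\<Sum>j<m. ennreal (4 * \<delta>) * krein_K P \<sigma>)"
    using \<delta>_pos by (intro sum_mono mult_left_mono le_krein_K) auto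
  also have "\<dots> = of_nat m * ennreal (4 * \<delta>) * krein_K P \<sigma>" by (simp add: mult.assoc)
  also have "of_nat m * ennreal (4 * \<delta>) = ennreal (real m * (4 * \<delta>))"
    by (simp add: ennreal_mult' ennreal_of_nat_eq_real_of_nat)
  also have "real m * (4 * \<delta>) = 4" using m_\<delta> by simp
  finally have "(\<integral>\<^sup>+k. (\<Sum>j<m. ennreal (4 * \<delta>) * ?p j k) \<partial>\<sigma>) \<le> 4 * krein_K P \<sigma>" by simp
  then show ?thesis
    unfolding block_def by (subst nn_integral_cmult) (auto intro: mult_left_mono)
qed

text \<open>The integers give \<open>122 = 2 * 61\<close>. The block energies of \<open>f\<close>
  add up to at most \<open>9/4\<close> of the log-weighted energy, and
  \<open>18 = 2 * (9/4) * 4\<close>.\<close>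

theorem nn_integral_majorant:
  assumes f: "L2_half_line (with_log f)"
  shows "(\<integral>\<^sup>+k. majorant f k \<partial>\<sigma>) \<le>
    (122 + 18 * krein_K P \<sigma>) * ennreal (integral {0..} (\<lambda>r. (cmod (with_log f r))\<^sup>2))"
proof -
  define W where "W = integral {0..} (\<lambda>r. (cmod (with_log f r))\<^sup>2)"
  have W: "0 \<le> W" unfolding W_def
    by (intro Henstock_Kurzweil_Integration.integral_nonneg L2_half_line_integrable f) auto
  have fL: "L2_half_line f" "L2_loc_half_line f"
    using f by (auto intro: L2_half_line_imp_loc L2_half_line_with_log)
  let ?E = "\<lambda>n. integral {real n..real n + 1} (\<lambda>r. (cmod (f r))\<^sup>2)"
  have E: "0 \<le> ?E n" for n
    by (intro Henstock_Kurzweil_Integration.integral_nonneg L2_loc_integrable fL) auto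
  have s1: "(\<Sum>n<N. ?E n) = integral {0..real N} (\<lambda>r. (cmod (f r))\<^sup>2)" for N
  proof (induction N)
    case (Suc N)
    have "integral {0..real N} (\<lambda>r. (cmod (f r))\<^sup>2) + ?E N = integral {0..real N + 1} (\<lambda>r. (cmod (f r))\<^sup>2)"
      using integral_square_diff[OF fL(2), of "real N" "real N + 1"] by simp
    then show ?case using Suc by (simp add: add.commute)
  qed simp
  have s2: "integral {0..real N} (\<lambda>r. (cmod (f r))\<^sup>2) \<le> integral {0..} (\<lambda>r. (cmod (f r))\<^sup>2)" for N
    by (intro integral_subset_le L2_loc_integrable L2_half_line_integrable fL) auto
  have s3: "integral {0..} (\<lambda>r. (cmod (f r))\<^sup>2) \<le> integral {0..} (\<lambda>r. 9/4 * (cmod (with_log f r))\<^sup>2)"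
    by (intro integral_le integrable_on_mult_right L2_half_line_integrable fL f square_le_with_log) auto
  have sumE: "(\<Sum>n<N. ?E n) \<le> 9/4 * W" for N
    using order_trans[OF s2 s3] unfolding W_def s1 integral_mult_right .
  have "(\<Sum>n. ennreal (?E n)) \<le> ennreal (9/4 * W)"
  proof (rule suminf_le_const[OF summableI])
    fix N
    have "(\<Sum>n<N. ennreal (?E n)) = ennreal (\<Sum>n<N. ?E n)" using E by (intro sum_ennreal) auto
    also have "\<dots> \<le> ennreal (9/4 * W)" by (rule ennreal_leI[OF sumE])
    finally show "(\<Sum>n<N. ennreal (?E n)) \<le> ennreal (9/4 * W)" .
  qed
  note E_le = this
  have "(\<integral>\<^sup>+k. (\<Sum>n. block f n k) \<partial>\<sigma>) = (\<Sum>n. \<integral>\<^sup>+k. block f n k \<partial>\<sigma>)"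
    by (rule nn_integral_suminf) measurable
  also have "\<dots> \<le> (\<Sum>n. ennreal (?E n) * (4 * krein_K P \<sigma>))"
    by (intro suminf_le summableI nn_integral_block)
  also have "\<dots> = (\<Sum>n. ennreal (?E n)) * (4 * krein_K P \<sigma>)" by (rule ennreal_suminf_multc)
  also have "\<dots> \<le> ennreal (9/4 * W) * (4 * krein_K P \<sigma>)" by (intro mult_right_mono E_le) simp
  finally have b: "(\<integral>\<^sup>+k. (\<Sum>n. block f n k) \<partial>\<sigma>) \<le> ennreal (9/4 * W) * (4 * krein_K P \<sigma>)" .
  have [measurable]: "partial f 0 (real n) \<in> borel_measurable \<sigma>" for n
    by (rule partial_measurable[OF fL(2)]) simp
  have "(\<integral>\<^sup>+k. majorant f k \<partial>\<sigma>) = 2 * (\<integral>\<^sup>+k. (SUP n. ennreal ((cmod (partial f 0 (real n) k))\<^sup>2)) \<partial>\<sigma>)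
      + 2 * (\<integral>\<^sup>+k. (\<Sum>n. block f n k) \<partial>\<sigma>)"
    unfolding majorant_def by (simp add: nn_integral_add nn_integral_cmult)
  also have "\<dots> \<le> 2 * ennreal (61 * W) + 2 * (ennreal (9/4 * W) * (4 * krein_K P \<sigma>))"
    by (intro add_mono mult_left_mono b nn_integral_SUP_partial[OF f, folded W_def]) auto
  also have "2 * ennreal (61 * W) = 122 * ennreal W"
    using W by (simp add: ennreal_mult' mult.assoc[symmetric])
  also have "2 * (ennreal (9/4 * W) * (4 * krein_K P \<sigma>)) = (2 * ennreal (9/4) * 4) * krein_K P \<sigma> * ennreal W"
    using W by (subst ennreal_mult') (auto simp: mult_ac)
  also have "2 * ennreal (9/4) * 4 = ennreal (2 * (9/4) * 4)"
    by (simp only: ennreal_mult' ennreal_numeral zero_le_numeral zero_le_divide_iff)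
  also have "\<dots> = 18" by simp
  also have "122 * ennreal W + 18 * krein_K P \<sigma> * ennreal W = (122 + 18 * krein_K P \<sigma>) * ennreal W"
    by (simp add: distrib_right)
  finally show ?thesis unfolding W_def .
qed

lemma krein_K_finite: "krein_K P \<sigma> < \<infinity>"
  using krein_K_le by (rule le_less_trans) simp

section \<open>Almost everywhere convergence\<close>

lemma partial_tail:
  assumes "real N \<le> t"
  shows "partial (tail f N) 0 t k = partial f (real N) t k"
proof -
  have "partial (tail f N) 0 t k = integral {0..t} (\<lambda>s. if s \<in> {real N..} then f s * P s (complex_of_real k) else 0)"
    unfolding partial_def tail_def by (intro integral_cong) auto
  also have "\<dots> = integral ({real N..} \<inter> {0..t}) (\<lambda>s. f s * P s (complex_of_real k))"
    by (rule Henstock_Kurzweil_Integration.integral_restrict_Int)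
  also have "{real N..} \<inter> {0..t} = {real N..t}" by auto
  finally show ?thesis unfolding partial_def .
qed

text \<open>The integrals of the tail majorants tend to zero, so the infimum of these majorants
  vanishes almost everywhere. Where it does, some tail has a majorant below
  \<open>e^2 / kappa k\<close>, and beyond that \<open>N\<close> no partial integral moves away from
  the one up to \<open>N\<close> by \<open>e\<close> or more.\<close>

theorem AE_partial_tendsto:
  assumes f: "L2_half_line (with_log f)"
  shows "AE k in \<sigma>. ((\<lambda>R. partial f 0 R k) \<longlongrightarrow> lim (\<lambda>n. partial f 0 (real n) k)) at_top"
proof -
  have tl: "L2_half_line (with_log (tail f N))" for N
    unfolding with_log_tail by (rule L2_half_line_tail[OF f])
  have tl_loc: "L2_loc_half_line (tail f N)" for N
    by (rule L2_half_line_imp_loc[OF L2_half_line_with_log[OF tl]])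
  have fL: "L2_loc_half_line f" by (rule L2_half_line_imp_loc[OF L2_half_line_with_log[OF f]])
  \<comment> \<open>With an infimum no monotonicity in \<open>N\<close> has to be shown: its
    integral lies below that of every majorant.\<close>
  let ?H = "\<lambda>k. INF N. majorant (tail f N) k"
  have [measurable]: "majorant (tail f N) \<in> borel_measurable \<sigma>" for N
    by (rule majorant_measurable[OF tl_loc])
  \<comment> \<open>Finiteness of \<open>K\<close> makes the constant real, so that the bounds
    \<open>c * ?W N\<close> tend to zero.\<close>
  obtain c where c: "122 + 18 * krein_K P \<sigma> = ennreal c" "c \<ge> 0"
    using krein_K_finite by (cases "krein_K P \<sigma>") (auto simp: ennreal_mult'[symmetric] ennreal_plus[symmetric]
        simp del: ennreal_plus simp flip: ennreal_numeral intro: that)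
  let ?W = "\<lambda>N. integral {0..} (\<lambda>r. (cmod (with_log (tail f N) r))\<^sup>2)"
  have "(\<lambda>N. ennreal (c * ?W N)) \<longlonglongrightarrow> ennreal (c * 0)"
    unfolding with_log_tail by (intro tendsto_ennrealI tendsto_mult tendsto_const tail_integral_tendsto f)
  moreover have "(\<integral>\<^sup>+k. ?H k \<partial>\<sigma>) \<le> ennreal (c * ?W N)" for N
  proof -
    have "(\<integral>\<^sup>+k. ?H k \<partial>\<sigma>) \<le> (\<integral>\<^sup>+k. majorant (tail f N) k \<partial>\<sigma>)"
      by (intro nn_integral_mono INF_lower) simp
    also have "\<dots> \<le> ennreal c * ennreal (?W N)" using nn_integral_majorant[OF tl] unfolding c(1) .
    also have "\<dots> = ennreal (c * ?W N)" using c(2) by (rule ennreal_mult'[symmetric])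
    finally show ?thesis .
  qed
  ultimately have "(\<integral>\<^sup>+k. ?H k \<partial>\<sigma>) \<le> 0"
    using LIMSEQ_le_const by fastforce
  then have "AE k in \<sigma>. ?H k = 0"
    by (subst nn_integral_0_iff_AE[symmetric]) auto
  then show ?thesis
  proof (rule eventually_mono)
    fix k assume H: "?H k = 0"
    show "((\<lambda>R. partial f 0 R k) \<longlongrightarrow> lim (\<lambda>n. partial f 0 (real n) k)) at_top"
    proof (rule tendsto_at_top_if_cauchy)
      fix e :: real assume "e > 0"
      have kp: "kappa k > 0" using kappa_ge_1[of k] by linarith
      then have "?H k < ennreal (e\<^sup>2 / kappa k)" using H \<open>e > 0\<close> by (simp add: ennreal_less_zero_iff)
      then obtain N where N: "majorant (tail f N) k < ennreal (e\<^sup>2 / kappa k)"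
        unfolding INF_less_iff by blast
      have "cmod (partial f 0 t k - partial f 0 (real N) k) < e" if t: "real N \<le> t" for t
      proof -
        have "0 \<le> t" using t of_nat_0_le_iff order_trans by blast
        from le_less_trans[OF partial_le_majorant[OF tl_loc this] N]
        have "(cmod (partial f (real N) t k))\<^sup>2 / kappa k < e\<^sup>2 / kappa k"
          unfolding partial_tail[OF t] using kp by (simp add: ennreal_less_iff)
        then have "(cmod (partial f (real N) t k))\<^sup>2 < e\<^sup>2" using kp by (simp add: divide_less_cancel)
        then have "cmod (partial f (real N) t k) < e" by (rule power_less_imp_less_base) (use \<open>e > 0\<close> in simp)
        then show ?thesis using partial_combine[OF fL order_refl _ t] by simp
      qed
      then show "\<exists>N. \<forall>t\<ge>real N. cmod (partial f 0 t k - partial f 0 (real N) k) < e" by blast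
    qed
  qed
qed


section \<open>The limit in the L2 space of the spectral measure\<close>

definition limit_transform :: "(real \<Rightarrow> complex) \<Rightarrow> real \<Rightarrow> complex" where
  "limit_transform f k = lim (\<lambda>n. partial f 0 (real n) k)"

lemma limit_transform_measurable:
  assumes "L2_loc_half_line f"
  shows "limit_transform f \<in> borel_measurable \<sigma>"
  unfolding limit_transform_def[abs_def]
  by (rule borel_measurable_lim_metric) (rule partial_measurable[OF assms order_refl])

text \<open>Fatou's lemma, applied to the increments between \<open>R\<close> and the integers.\<close>

lemma nn_integral_partial_minus_limit:
  assumes f: "L2_half_line (with_log f)" and R: "real N \<le> R"
  shows "(\<integral>\<^sup>+k. ennreal ((cmod (partial f 0 R k - limit_transform f k))\<^sup>2) \<partial>\<sigma>)
    \<le> ennreal (integral {0..} (\<lambda>r. (cmod (tail f N r))\<^sup>2))"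
proof -
  have fL: "L2_half_line f" "L2_loc_half_line f"
    using f by (auto intro: L2_half_line_imp_loc L2_half_line_with_log)
  have R0: "0 \<le> R" using R by (rule order_trans[OF of_nat_0_le_iff])
  have [measurable]: "partial f 0 t \<in> borel_measurable \<sigma>" for t
    by (rule partial_measurable[OF fL(2) order_refl])
  let ?d = "\<lambda>n k. ennreal ((cmod (partial f 0 R k - partial f 0 (real n) k))\<^sup>2)"
  have "AE k in \<sigma>. ennreal ((cmod (partial f 0 R k - limit_transform f k))\<^sup>2) = liminf (\<lambda>n. ?d n k)"
    using AE_partial_tendsto[OF f]
  proof (rule eventually_mono)
    fix k assume "((\<lambda>R. partial f 0 R k) \<longlongrightarrow> lim (\<lambda>n. partial f 0 (real n) k)) at_top"
    from filterlim_compose[OF this filterlim_real_sequentially]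
    have "(\<lambda>n. partial f 0 (real n) k) \<longlonglongrightarrow> limit_transform f k" by (simp add: limit_transform_def)
    then have "(\<lambda>n. ?d n k) \<longlonglongrightarrow> ennreal ((cmod (partial f 0 R k - limit_transform f k))\<^sup>2)"
      by (intro tendsto_ennrealI tendsto_intros)
    from lim_imp_Liminf[OF sequentially_bot this]
    show "ennreal ((cmod (partial f 0 R k - limit_transform f k))\<^sup>2) = liminf (\<lambda>n. ?d n k)" by simp
  qed
  then have "(\<integral>\<^sup>+k. ennreal ((cmod (partial f 0 R k - limit_transform f k))\<^sup>2) \<partial>\<sigma>)
      = (\<integral>\<^sup>+k. liminf (\<lambda>n. ?d n k) \<partial>\<sigma>)"
    by (rule nn_integral_cong_AE)
  also have "\<dots> \<le> liminf (\<lambda>n. \<integral>\<^sup>+k. ?d n k \<partial>\<sigma>)"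
    by (rule nn_integral_liminf) measurable
  also have "\<dots> \<le> liminf (\<lambda>n::nat. ennreal (integral {0..} (\<lambda>r. (cmod (tail f N r))\<^sup>2)))"
  proof (rule Liminf_mono)
    \<comment> \<open>The lower limit ignores finitely many \<open>n\<close>, so \<open>n\<close>
      may be taken beyond \<open>R\<close>.\<close>
    obtain n0 where n0: "R \<le> real n0" using real_arch_simple by blast
    have "(\<integral>\<^sup>+k. ?d n k \<partial>\<sigma>) \<le> ennreal (integral {0..} (\<lambda>r. (cmod (tail f N r))\<^sup>2))" if "n \<ge> n0" for n
    proof -
      have n: "R \<le> real n" using n0 that by linarith
      have "cmod (partial f 0 R k - partial f 0 (real n) k) = cmod (partial f R (real n) k)" for k
        using partial_combine[OF fL(2) order_refl R0 n, of k] by simp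
      then have "(\<integral>\<^sup>+k. ?d n k \<partial>\<sigma>) = ennreal (integral {R..real n} (\<lambda>r. (cmod (f r))\<^sup>2))"
        using isometry[OF fL(2) R0 n] by simp
      \<comment> \<open>Since \<open>R \<ge> N\<close>, the function agrees with its tail here; the
        resulting bound holds for all such \<open>R\<close> at once.\<close>
      also have "integral {R..real n} (\<lambda>r. (cmod (f r))\<^sup>2) = integral {R..real n} (\<lambda>r. (cmod (tail f N r))\<^sup>2)"
        using R by (intro integral_cong) (simp add: tail_def)
      also have "\<dots> \<le> integral {0..} (\<lambda>r. (cmod (tail f N r))\<^sup>2)"
        using R0 by (intro integral_subset_le L2_loc_integrable L2_half_line_integrable
            L2_half_line_imp_loc L2_half_line_tail fL) auto
      finally show ?thesis by (simp add: ennreal_leI)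
    qed
    then show "\<forall>\<^sub>F n in sequentially. (\<integral>\<^sup>+k. ?d n k \<partial>\<sigma>) \<le> ennreal (integral {0..} (\<lambda>r. (cmod (tail f N r))\<^sup>2))"
      unfolding eventually_sequentially by blast
  qed
  also have "\<dots> = ennreal (integral {0..} (\<lambda>r. (cmod (tail f N r))\<^sup>2))"
    by (rule Liminf_const) simp
  finally show ?thesis .
qed

lemma L2_limit_transform:
  assumes f: "L2_half_line (with_log f)"
  shows "krein_transform_L2_limit P \<sigma> f (limit_transform f)"
proof -
  have fL: "L2_half_line f" "L2_loc_half_line f"
    using f by (auto intro: L2_half_line_imp_loc L2_half_line_with_log)
  have "(\<integral>\<^sup>+k. ennreal ((cmod (limit_transform f k))\<^sup>2) \<partial>\<sigma>) < \<infinity>"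
    \<comment> \<open>With \<open>N = R = 0\<close> the partial integral is zero, and the estimate
      of the difference becomes one for the limit itself.\<close>
    using nn_integral_partial_minus_limit[OF f, of 0 0]
    by (simp add: partial_def le_less_trans)
  moreover have "((\<lambda>R. \<integral>\<^sup>+k. ennreal ((cmod (partial f 0 R k - limit_transform f k))\<^sup>2) \<partial>\<sigma>) \<longlongrightarrow> 0) at_top"
  proof (rule order_tendstoI)
    fix e :: ennreal assume "0 < e"
    have "(\<lambda>N. ennreal (integral {0..} (\<lambda>r. (cmod (tail f N r))\<^sup>2))) \<longlonglongrightarrow> ennreal 0"
      by (intro tendsto_ennrealI tail_integral_tendsto fL)
    then have "\<forall>\<^sub>F N in sequentially. ennreal (integral {0..} (\<lambda>r. (cmod (tail f N r))\<^sup>2)) < e"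
      using \<open>0 < e\<close> by (intro order_tendstoD) simp_all
    then obtain N where N: "ennreal (integral {0..} (\<lambda>r. (cmod (tail f N r))\<^sup>2)) < e"
      unfolding eventually_sequentially by blast
    have "\<forall>\<^sub>F R in at_top. real N \<le> R" by (rule eventually_ge_at_top)
    then show "\<forall>\<^sub>F R in at_top. (\<integral>\<^sup>+k. ennreal ((cmod (partial f 0 R k - limit_transform f k))\<^sup>2) \<partial>\<sigma>) < e"
      by (rule eventually_mono) (rule le_less_trans[OF nn_integral_partial_minus_limit[OF f] N])
  qed simp
  ultimately show ?thesis
    unfolding krein_transform_L2_limit_def krein_transform_eq_partial[OF fL(2)]
    using limit_transform_measurable[OF fL(2)] by blast
qed

text \<open>Carries the convergence proved for \<open>limit_transform\<close> over to an arbitrary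
  representative of the limit.\<close>

lemma L2_limit_unique:
  assumes f: "L2_loc_half_line f"
    and F: "krein_transform_L2_limit P \<sigma> f F" and G: "krein_transform_L2_limit P \<sigma> f G"
  shows "AE k in \<sigma>. F k = G k"
proof -
  have [measurable]: "partial f 0 R \<in> borel_measurable \<sigma>" for R
    by (rule partial_measurable[OF f order_refl])
  have [measurable]: "F \<in> borel_measurable \<sigma>" "G \<in> borel_measurable \<sigma>"
    using F G by (auto simp: krein_transform_L2_limit_def)
  let ?I = "\<lambda>H R. \<integral>\<^sup>+k. ennreal ((cmod (partial f 0 R k - H k))\<^sup>2) \<partial>\<sigma>"
  have lim: "(?I F \<longlongrightarrow> 0) at_top" "(?I G \<longlongrightarrow> 0) at_top"
    using F G unfolding krein_transform_L2_limit_def krein_transform_eq_partial[OF f] by blast+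
  have le: "(\<integral>\<^sup>+k. ennreal ((cmod (F k - G k))\<^sup>2) \<partial>\<sigma>) \<le> 2 * ?I F R + 2 * ?I G R" for R
  proof -
    have "ennreal ((cmod (F k - G k))\<^sup>2) \<le> 2 * ennreal ((cmod (partial f 0 R k - F k))\<^sup>2)
        + 2 * ennreal ((cmod (partial f 0 R k - G k))\<^sup>2)" for k
    proof -
      let ?x = "cmod (partial f 0 R k - F k)" and ?y = "cmod (partial f 0 R k - G k)"
      have "cmod (F k - G k) \<le> ?x + ?y"
        using norm_triangle_ineq4[of "partial f 0 R k - G k" "partial f 0 R k - F k"] by simp
      then have "(cmod (F k - G k))\<^sup>2 \<le> (?x + ?y)\<^sup>2" by (intro power_mono) auto
      also have "\<dots> \<le> (1 + 1/1) * ?x\<^sup>2 + (1 + 1) * ?y\<^sup>2" by (rule square_add_le) simp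
      finally have "ennreal ((cmod (F k - G k))\<^sup>2) \<le> ennreal (2 * ?x\<^sup>2 + 2 * ?y\<^sup>2)"
        by (intro ennreal_leI) simp
      then show ?thesis by (simp add: ennreal_mult')
    qed
    then have "(\<integral>\<^sup>+k. ennreal ((cmod (F k - G k))\<^sup>2) \<partial>\<sigma>) \<le> (\<integral>\<^sup>+k. 2 * ennreal ((cmod (partial f 0 R k - F k))\<^sup>2)
        + 2 * ennreal ((cmod (partial f 0 R k - G k))\<^sup>2) \<partial>\<sigma>)"
      by (intro nn_integral_mono)
    also have "\<dots> = 2 * ?I F R + 2 * ?I G R"
      by (subst nn_integral_add) (simp_all add: nn_integral_cmult)
    finally show ?thesis .
  qed
  have "((\<lambda>R. 2 * ?I F R + 2 * ?I G R) \<longlongrightarrow> 2 * 0 + 2 * 0) at_top"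
    by (intro tendsto_add ennreal_tendsto_cmult lim) auto
  then have "(\<integral>\<^sup>+k. ennreal ((cmod (F k - G k))\<^sup>2) \<partial>\<sigma>) \<le> 2 * 0 + 2 * 0"
    by (rule tendsto_lowerbound) (auto simp: le)
  then have "(\<integral>\<^sup>+k. ennreal ((cmod (F k - G k))\<^sup>2) \<partial>\<sigma>) = 0" by simp
  then have "AE k in \<sigma>. ennreal ((cmod (F k - G k))\<^sup>2) = 0"
    by (subst (asm) nn_integral_0_iff_AE) auto
  then show ?thesis by (rule eventually_mono) simp
qed

theorem AE_krein_transform_tendsto:
  assumes f: "L2_half_line (with_log f)" and F: "krein_transform_L2_limit P \<sigma> f F"
  shows "AE k in \<sigma>. ((\<lambda>R. krein_transform P f R k) \<longlongrightarrow> F k) at_top"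
proof -
  have fL: "L2_loc_half_line f" by (rule L2_half_line_imp_loc[OF L2_half_line_with_log[OF f]])
  have "AE k in \<sigma>. F k = limit_transform f k"
    by (rule L2_limit_unique[OF fL F L2_limit_transform[OF f]])
  with AE_partial_tendsto[OF f] show ?thesis
    unfolding krein_transform_eq_partial[OF fL]
    by eventually_elim (simp add: limit_transform_def)
qed

text \<open>The supremum over real \<open>t\<close> is compared pointwise with the measurable
  majorant. The constant 300 meets \<open>122 \<le> 300 * (1/2)\<close>, where the
  \<open>1/2\<close> is that of \<open>Linf_norm_kappa_ge\<close>, and
  \<open>18 \<le> 300\<close>.\<close>

theorem maximal_inequality:
  assumes f: "L2_half_line (with_log f)"
  shows "(\<integral>\<^sup>+k. (SUP t\<in>{0<..}. ennreal ((cmod (krein_transform P f t k))\<^sup>2)) / ennreal (kappa k) \<partial>\<sigma>)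
    \<le> 300 * (Linf_norm (\<lambda>k. 1 / kappa k) + krein_K P \<sigma>) *
      (\<integral>\<^sup>+r\<in>{0..}. ennreal ((cmod (f r))\<^sup>2 * (ln (2 + r))\<^sup>2) \<partial>lebesgue)"
proof -
  have fL: "L2_loc_half_line f" by (rule L2_half_line_imp_loc[OF L2_half_line_with_log[OF f]])
  let ?W = "ennreal (integral {0..} (\<lambda>r. (cmod (with_log f r))\<^sup>2))"
  have "(SUP t\<in>{0<..}. ennreal ((cmod (krein_transform P f t k))\<^sup>2)) / ennreal (kappa k) \<le> majorant f k" for k
  proof (rule divide_le_posI_ennreal)
    have k: "kappa k > 0" using kappa_ge_1[of k] by linarith
    then show "0 < ennreal (kappa k)" by simp
    show "(SUP t\<in>{0<..}. ennreal ((cmod (krein_transform P f t k))\<^sup>2)) \<le> ennreal (kappa k) * majorant f k"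
    proof (rule SUP_least)
      fix t :: real assume "t \<in> {0<..}"
      then have t: "0 \<le> t" by simp
      have "ennreal ((cmod (partial f 0 t k))\<^sup>2) = ennreal ((cmod (partial f 0 t k))\<^sup>2 / kappa k * kappa k)"
        using k by simp
      also have "\<dots> = ennreal ((cmod (partial f 0 t k))\<^sup>2 / kappa k) * ennreal (kappa k)"
        using k by (intro ennreal_mult') simp
      also have "\<dots> \<le> majorant f k * ennreal (kappa k)"
        by (intro mult_right_mono partial_le_majorant[OF fL t]) simp
      finally show "ennreal ((cmod (krein_transform P f t k))\<^sup>2) \<le> ennreal (kappa k) * majorant f k"
        unfolding krein_transform_eq_partial[OF fL] mult.commute[of "ennreal (kappa k)"] .
    qed
  qed
  then have "(\<integral>\<^sup>+k. (SUP t\<in>{0<..}. ennreal ((cmod (krein_transform P f t k))\<^sup>2)) / ennreal (kappa k) \<partial>\<sigma>)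
    \<le> (\<integral>\<^sup>+k. majorant f k \<partial>\<sigma>)"
    by (intro nn_integral_mono)
  also have "\<dots> \<le> (122 + 18 * krein_K P \<sigma>) * ?W" by (rule nn_integral_majorant[OF f])
  also have "\<dots> \<le> 300 * (Linf_norm (\<lambda>k. 1 / kappa k) + krein_K P \<sigma>) * ?W"
  proof (rule mult_right_mono)
    have "(122::ennreal) = ennreal 122" by simp
    also have "\<dots> \<le> ennreal (300 * (1/2))" by (rule ennreal_leI) simp
    also have "\<dots> = 300 * ennreal (1/2)" by (subst ennreal_mult') simp_all
    also have "\<dots> \<le> 300 * Linf_norm (\<lambda>k. 1 / kappa k)"
      by (intro mult_left_mono Linf_norm_kappa_ge) simp
    finally have "122 + 18 * krein_K P \<sigma> \<le> 300 * Linf_norm (\<lambda>k. 1 / kappa k) + 300 * krein_K P \<sigma>"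
      by (intro add_mono mult_right_mono) auto
    then show "122 + 18 * krein_K P \<sigma> \<le> 300 * (Linf_norm (\<lambda>k. 1 / kappa k) + krein_K P \<sigma>)"
      by (simp only: distrib_left)
  qed simp
  also have "?W = (\<integral>\<^sup>+r\<in>{0..}. ennreal ((cmod (with_log f r))\<^sup>2) \<partial>lebesgue)"
    by (rule nn_integral_cmod_square[OF L2_half_line_integrable[OF f], symmetric])
  finally show ?thesis unfolding cmod_with_log .
qed

end

theorem lemma1p4:
  shows "\<exists>C::real. C > 0 \<and>
    (\<forall>(A :: real \<Rightarrow> complex) (P :: real \<Rightarrow> complex \<Rightarrow> complex) (Pstar :: real \<Rightarrow> complex \<Rightarrow> complex)
      (\<sigma> :: real measure).
      L2_loc_half_line A \<and> krein_system A P Pstar \<and> orthogonality_measure P \<sigma> \<and> stummel_class A \<longrightarrow>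
        (SUP r\<in>{0<..}. \<integral>\<^sup>+k. ennreal ((cmod (P r (complex_of_real k)))\<^sup>2 / (1 + k\<^sup>2)) \<partial>\<sigma>)
          \<le> ennreal (C * (1 + (stummel_norm A)\<^sup>2)) \<and>
        krein_K P \<sigma> \<le> ennreal (C * (1 + (stummel_norm A)\<^sup>2)) \<and>
        (\<forall>f :: real \<Rightarrow> complex. L2_half_line (\<lambda>r. f r * complex_of_real (ln (2 + r))) \<longrightarrow>
          (\<integral>\<^sup>+k. (SUP t\<in>{0<..}. ennreal ((cmod (krein_transform P f t k))\<^sup>2)) / ennreal (kappa k) \<partial>\<sigma>)
            \<le> ennreal C * (Linf_norm (\<lambda>k. 1 / kappa k) + krein_K P \<sigma>) *
               (\<integral>\<^sup>+r\<in>{0..}. ennreal ((cmod (f r))\<^sup>2 * (ln (2 + r))\<^sup>2) \<partial>lebesgue) \<and>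
          (\<exists>F. krein_transform_L2_limit P \<sigma> f F) \<and>
          (\<forall>F. krein_transform_L2_limit P \<sigma> f F \<longrightarrow>
            (AE k in \<sigma>. ((\<lambda>R. krein_transform P f R k) \<longlongrightarrow> F k) at_top))))"
\<comment> \<open>This is the constant of the maximal inequality; it also exceeds the 136 in the
  bound on \<open>K\<close>.\<close>
proof (intro exI[of _ 300] conjI allI impI)
  fix A P Pstar \<sigma>
  assume H: "L2_loc_half_line A \<and> krein_system A P Pstar \<and> orthogonality_measure P \<sigma> \<and> stummel_class A"
  interpret krein A P Pstar \<sigma> by unfold_locales (use H in blast)+
  have C: "ennreal (136 * (1 + (stummel_norm A)\<^sup>2)) \<le> ennreal (300 * (1 + (stummel_norm A)\<^sup>2))"
    by (intro ennreal_leI mult_right_mono) auto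
  show "(SUP r\<in>{0<..}. \<integral>\<^sup>+k. ennreal ((cmod (P r (complex_of_real k)))\<^sup>2 / (1 + k\<^sup>2)) \<partial>\<sigma>)
      \<le> ennreal (300 * (1 + (stummel_norm A)\<^sup>2))"
  proof (rule SUP_least)
    fix r :: real assume "r \<in> {0<..}"
    then have "0 \<le> r" by simp
    then show "(\<integral>\<^sup>+k. ennreal ((cmod (P r (complex_of_real k)))\<^sup>2 / (1 + k\<^sup>2)) \<partial>\<sigma>)
        \<le> ennreal (300 * (1 + (stummel_norm A)\<^sup>2))"
      by (rule order_trans[OF nn_integral_P_le C])
  qed
  show "krein_K P \<sigma> \<le> ennreal (300 * (1 + (stummel_norm A)\<^sup>2))"
    by (rule order_trans[OF krein_K_le C])
  fix f assume "L2_half_line (\<lambda>r. f r * complex_of_real (ln (2 + r)))"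
  then have f: "L2_half_line (with_log f)" by (simp add: with_log_def[abs_def])
  show "(\<integral>\<^sup>+k. (SUP t\<in>{0<..}. ennreal ((cmod (krein_transform P f t k))\<^sup>2)) / ennreal (kappa k) \<partial>\<sigma>)
      \<le> ennreal 300 * (Linf_norm (\<lambda>k. 1 / kappa k) + krein_K P \<sigma>) *
         (\<integral>\<^sup>+r\<in>{0..}. ennreal ((cmod (f r))\<^sup>2 * (ln (2 + r))\<^sup>2) \<partial>lebesgue)"
    using maximal_inequality[OF f] by simp
  show "\<exists>F. krein_transform_L2_limit P \<sigma> f F" using L2_limit_transform[OF f] by blast
  fix F assume "krein_transform_L2_limit P \<sigma> f F"
  then show "AE k in \<sigma>. ((\<lambda>R. krein_transform P f R k) \<longlongrightarrow> F k) at_top"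
    by (rule AE_krein_transform_tendsto[OF f])
qed simp

end
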